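(* Let $(A,\ast,\circ)$ be a pre-Poisson algebra and $(B,\diamond)$ a perm algebra. Define two binary operations on $A\otimes B$ by $$[a_1\otimes b_1,\;a_2\otimes b_2]=(a_1\circ a_2)\otimes(b_1\diamond b_2)-(a_2\circ a_1)\otimes(b_2\diamond b_1),$$ $$(a_1\otimes b_1)\cdot(a_2\otimes b_2)=(a_1\ast a_2)\otimes(b_1\diamond b_2)+(a_2\ast a_1)\otimes(b_2\diamond b_1),$$ for all $a_1,a_2\in A$, $b_1,b_2\in B$. Then $(A\otimes B,\cdot,[-,-])$ is a Poisson algebra.
   Context: All vector spaces are over a field $\mathbf k$ of characteristic zero. A Zinbiel algebra $(A,\ast)$ is a vector space with a bilinear operation such that $a_1\ast(a_2\ast a_3)=(a_1\ast a_2)\ast a_3+(a_2\ast a_1)\ast a_3$. A pre-Lie algebra $(A,\circ)$ satisfies $(a_1\circ a_2)\circ a_3-a_1\circ(a_2\circ a_3)=(a_2\circ a_1)\circ a_3-a_2\circ(a_1\circ a_3)$. A pre-Poisson algebra $(A,\ast,\circ)$ is a vector space such that $(A,\ast)$ is a Zinbiel algebra, $(A,\circ)$ is a pre-Lie algebra, and $(a_1\circ a_2-a_2\circ a_1)\ast a_3=a_1\circ(a_2\ast a_3)-a_2\ast(a_1\circ a_3)$, $(a_1\ast a_2+a_2\ast a_1)\circ a_3=a_1\ast(a_2\circ a_3)+a_2\ast(a_1\circ a_3)$. A perm algebra $(B,\diamond)$ satisfies $b_1\diamond(b_2\diamond b_3)=(b_1\diamond b_2)\diamond b_3=(b_2\diamond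 b_1)\diamond b_3$. A Poisson algebra $(P,\cdot,[-,-])$: $(P,\cdot)$ is a commutative associative algebra (no unit required), $(P,[-,-])$ is a Lie algebra, and $[p_1,p_2p_3]=[p_1,p_2]p_3+p_2[p_1,p_3]$. *)

theory Defs
  imports "HOL-Algebra.Module" "HOL-Algebra.AbelCoset"
begin

section \<open>Vector spaces and bilinear maps\<close>

locale char_zero_field = field K for K (structure) +
  assumes char_zero: "(n::nat) > 0 \<Longrightarrow> [n] \<cdot> \<one> \<noteq> \<zero>"

locale vspace = char_zero_field K + module K V for K (structure) and V (structure)

definition bilinear_map ::
  "('k, 'r) ring_scheme \<Rightarrow> ('k, 'u, 'm) module_scheme \<Rightarrow> ('k, 'v, 'n) module_scheme \<Rightarrow>
   ('k, 'w, 'p) module_scheme \<Rightarrow> ('u \<Rightarrow> 'v \<Rightarrow> 'w) \<Rightarrow> bool"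
  where "bilinear_map K U V W f \<longleftrightarrow>
    (\<forall>u\<in>carrier U. \<forall>v\<in>carrier V. f u v \<in> carrier W) \<and>
    (\<forall>u\<in>carrier U. \<forall>u'\<in>carrier U. \<forall>v\<in>carrier V. f (u \<oplus>\<^bsub>U\<^esub> u') v = f u v \<oplus>\<^bsub>W\<^esub> f u' v) \<and>
    (\<forall>u\<in>carrier U. \<forall>v\<in>carrier V. \<forall>v'\<in>carrier V. f u (v \<oplus>\<^bsub>V\<^esub> v') = f u v \<oplus>\<^bsub>W\<^esub> f u v') \<and>
    (\<forall>c\<in>carrier K. \<forall>u\<in>carrier U. \<forall>v\<in>carrier V. f (c \<odot>\<^bsub>U\<^esub> u) v = c \<odot>\<^bsub>W\<^esub> f u v) \<and>
    (\<forall>c\<in>carrier K. \<forall>u\<in>carrier U. \<forall>v\<in>carrier V. f u (c \<odot>\<^bsub>V\<^esub> v) = c \<odot>\<^bsub>W\<^esub> f u v)"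

section \<open>Classes of algebras\<close>

text \<open>
  The operations are separate parameters, because an algebra may carry two of them.
  The fields \<open>mult\<close> and \<open>one\<close> that a module record inherits from the ring record are not used.
\<close>

locale bilinear_algebra = vspace K A for K (structure) and A (structure) +
  fixes m :: "'b \<Rightarrow> 'b \<Rightarrow> 'b"
  assumes bilinear: "bilinear_map K A A A m"

locale zinbiel_algebra = bilinear_algebra K A ast
  for K (structure) and A (structure) and ast (infixl \<open>\<star>\<close> 75) +
  assumes zinbiel:
    "\<lbrakk>x \<in> carrier A; y \<in> carrier A; z \<in> carrier A\<rbrakk> \<Longrightarrow>
      x \<star> (y \<star> z) = (x \<star> y) \<star> z \<oplus>\<^bsub>A\<^esub> (y \<star> x) \<star> z"

locale pre_lie_algebra = bilinear_algebra K A circ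
  for K (structure) and A (structure) and circ (infixl \<open>\<triangleright>\<close> 75) +
  assumes pre_lie:
    "\<lbrakk>x \<in> carrier A; y \<in> carrier A; z \<in> carrier A\<rbrakk> \<Longrightarrow>
      (x \<triangleright> y) \<triangleright> z \<ominus>\<^bsub>A\<^esub> x \<triangleright> (y \<triangleright> z) = (y \<triangleright> x) \<triangleright> z \<ominus>\<^bsub>A\<^esub> y \<triangleright> (x \<triangleright> z)"

locale pre_poisson_algebra =
  zinbiel: zinbiel_algebra K A ast + pre_lie: pre_lie_algebra K A circ
  for K (structure) and A (structure)
    and ast (infixl \<open>\<star>\<close> 75) and circ (infixl \<open>\<triangleright>\<close> 75) +
  assumes commutator_act:
    "\<lbrakk>x \<in> carrier A; y \<in> carrier A; z \<in> carrier A\<rbrakk> \<Longrightarrow>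
      (x \<triangleright> y \<ominus>\<^bsub>A\<^esub> y \<triangleright> x) \<star> z = x \<triangleright> (y \<star> z) \<ominus>\<^bsub>A\<^esub> y \<star> (x \<triangleright> z)"
    and anticommutator_act:
    "\<lbrakk>x \<in> carrier A; y \<in> carrier A; z \<in> carrier A\<rbrakk> \<Longrightarrow>
      (x \<star> y \<oplus>\<^bsub>A\<^esub> y \<star> x) \<triangleright> z = x \<star> (y \<triangleright> z) \<oplus>\<^bsub>A\<^esub> y \<star> (x \<triangleright> z)"

locale perm_algebra = bilinear_algebra K B dia
  for K (structure) and B (structure) and dia (infixl \<open>\<diamondop>\<close> 75) +
  assumes perm_assoc:
    "\<lbrakk>x \<in> carrier B; y \<in> carrier B; z \<in> carrier B\<rbrakk> \<Longrightarrow> x \<diamondop> (y \<diamondop> z) = (x \<diamondop> y) \<diamondop> z"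
    and perm_left_comm:
    "\<lbrakk>x \<in> carrier B; y \<in> carrier B; z \<in> carrier B\<rbrakk> \<Longrightarrow> (x \<diamondop> y) \<diamondop> z = (y \<diamondop> x) \<diamondop> z"

locale comm_assoc_algebra = bilinear_algebra K P mul
  for K (structure) and P (structure) and mul (infixl \<open>\<bullet>\<close> 75) +
  assumes commutative:
    "\<lbrakk>x \<in> carrier P; y \<in> carrier P\<rbrakk> \<Longrightarrow> x \<bullet> y = y \<bullet> x"
    and associative:
    "\<lbrakk>x \<in> carrier P; y \<in> carrier P; z \<in> carrier P\<rbrakk> \<Longrightarrow> (x \<bullet> y) \<bullet> z = x \<bullet> (y \<bullet> z)"

locale lie_algebra = bilinear_algebra K P br
  for K (structure) and P (structure) and br +
  assumes alternating: "x \<in> carrier P \<Longrightarrow> br x x = \<zero>\<^bsub>P\<^esub>"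
    and jacobi:
    "\<lbrakk>x \<in> carrier P; y \<in> carrier P; z \<in> carrier P\<rbrakk> \<Longrightarrow>
      br x (br y z) \<oplus>\<^bsub>P\<^esub> br y (br z x) \<oplus>\<^bsub>P\<^esub> br z (br x y) = \<zero>\<^bsub>P\<^esub>"

locale poisson_algebra =
  comm_assoc: comm_assoc_algebra K P mul + lie: lie_algebra K P br
  for K (structure) and P (structure) and mul (infixl \<open>\<bullet>\<close> 75) and br +
  assumes leibniz:
    "\<lbrakk>x \<in> carrier P; y \<in> carrier P; z \<in> carrier P\<rbrakk> \<Longrightarrow>
      br x (y \<bullet> z) = br x y \<bullet> z \<oplus>\<^bsub>P\<^esub> y \<bullet> br x z"

section \<open>The tensor product\<close>

text \<open>
  The space \<open>A \<otimes> B\<close> is the quotient of the free vector space on \<open>carrier A \<times> carrier B\<close>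
  by the subspace generated by the bilinearity relations.
\<close>

definition free_module :: "('k, 'r) ring_scheme \<Rightarrow> 'x set \<Rightarrow> ('k, 'x \<Rightarrow> 'k) module"
  where "free_module K X =
    \<lparr>carrier = {f. (\<forall>x. f x \<in> carrier K) \<and> (\<forall>x. x \<notin> X \<longrightarrow> f x = \<zero>\<^bsub>K\<^esub>) \<and> finite {x. f x \<noteq> \<zero>\<^bsub>K\<^esub>}},
     mult = undefined, one = undefined,
     zero = (\<lambda>_. \<zero>\<^bsub>K\<^esub>), add = (\<lambda>f g x. f x \<oplus>\<^bsub>K\<^esub> g x), smult = (\<lambda>c f x. c \<otimes>\<^bsub>K\<^esub> f x)\<rparr>"

definition free_gen :: "('k, 'r) ring_scheme \<Rightarrow> 'x \<Rightarrow> 'x \<Rightarrow> 'k"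
  where "free_gen K x = (\<lambda>y. if y = x then \<one>\<^bsub>K\<^esub> else \<zero>\<^bsub>K\<^esub>)"

definition submodule_gen :: "('k, 'r) ring_scheme \<Rightarrow> ('k, 'v, 'm) module_scheme \<Rightarrow> 'v set \<Rightarrow> 'v set"
  where "submodule_gen K M S = \<Inter>{N. submodule N K M \<and> S \<subseteq> N}"

definition quot_module :: "('k, 'v, 'm) module_scheme \<Rightarrow> 'v set \<Rightarrow> ('k, 'v set) module"
  where "quot_module M N =
    \<lparr>carrier = a_rcosets\<^bsub>M\<^esub> N,
     mult = undefined, one = undefined,
     zero = N, add = (\<lambda>C D. C <+>\<^bsub>M\<^esub> D), smult = (\<lambda>c C. \<Union>x\<in>C. N +>\<^bsub>M\<^esub> (c \<odot>\<^bsub>M\<^esub> x))\<rparr>"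

definition bilinear_relators ::
  "('k, 'r) ring_scheme \<Rightarrow> ('k, 'a, 'm) module_scheme \<Rightarrow> ('k, 'b, 'n) module_scheme \<Rightarrow>
   ('a \<times> 'b \<Rightarrow> 'k) set"
  where "bilinear_relators K A B =
    (let F = free_module K (carrier A \<times> carrier B); \<delta> = (\<lambda>a b. free_gen K (a, b)) in
      {\<delta> (a \<oplus>\<^bsub>A\<^esub> a') b \<ominus>\<^bsub>F\<^esub> (\<delta> a b \<oplus>\<^bsub>F\<^esub> \<delta> a' b) | a a' b.
        a \<in> carrier A \<and> a' \<in> carrier A \<and> b \<in> carrier B} \<union>
      {\<delta> a (b \<oplus>\<^bsub>B\<^esub> b') \<ominus>\<^bsub>F\<^esub> (\<delta> a b \<oplus>\<^bsub>F\<^esub> \<delta> a b') | a b b'.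
        a \<in> carrier A \<and> b \<in> carrier B \<and> b' \<in> carrier B} \<union>
      {\<delta> (c \<odot>\<^bsub>A\<^esub> a) b \<ominus>\<^bsub>F\<^esub> c \<odot>\<^bsub>F\<^esub> \<delta> a b | c a b.
        c \<in> carrier K \<and> a \<in> carrier A \<and> b \<in> carrier B} \<union>
      {\<delta> a (c \<odot>\<^bsub>B\<^esub> b) \<ominus>\<^bsub>F\<^esub> c \<odot>\<^bsub>F\<^esub> \<delta> a b | c a b.
        c \<in> carrier K \<and> a \<in> carrier A \<and> b \<in> carrier B})"

definition tensor_null ::
  "('k, 'r) ring_scheme \<Rightarrow> ('k, 'a, 'm) module_scheme \<Rightarrow> ('k, 'b, 'n) module_scheme \<Rightarrow>
   ('a \<times> 'b \<Rightarrow> 'k) set"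
  where "tensor_null K A B =
    submodule_gen K (free_module K (carrier A \<times> carrier B)) (bilinear_relators K A B)"

definition tensor_space ::
  "('k, 'r) ring_scheme \<Rightarrow> ('k, 'a, 'm) module_scheme \<Rightarrow> ('k, 'b, 'n) module_scheme \<Rightarrow>
   ('k, ('a \<times> 'b \<Rightarrow> 'k) set) module"
  where "tensor_space K A B =
    quot_module (free_module K (carrier A \<times> carrier B)) (tensor_null K A B)"

definition pure_tensor ::
  "('k, 'r) ring_scheme \<Rightarrow> ('k, 'a, 'm) module_scheme \<Rightarrow> ('k, 'b, 'n) module_scheme \<Rightarrow>
   'a \<Rightarrow> 'b \<Rightarrow> ('a \<times> 'b \<Rightarrow> 'k) set"
  where "pure_tensor K A B a b =
    tensor_null K A B +>\<^bsub>free_module K (carrier A \<times> carrier B)\<^esub> free_gen K (a, b)"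

section \<open>The two operations on the tensor product\<close>

text \<open>
  A formula on pure tensors defines an operation on \<open>A \<otimes> B\<close> by bilinear extension; the predicates
  below single out the operations that are bilinear and given by the formula on pure tensors.
\<close>

definition is_tensor_bracket ::
  "('k, 'r) ring_scheme \<Rightarrow> ('k, 'a, 'm) module_scheme \<Rightarrow> ('a \<Rightarrow> 'a \<Rightarrow> 'a) \<Rightarrow>
   ('k, 'b, 'n) module_scheme \<Rightarrow> ('b \<Rightarrow> 'b \<Rightarrow> 'b) \<Rightarrow>
   (('a \<times> 'b \<Rightarrow> 'k) set \<Rightarrow> ('a \<times> 'b \<Rightarrow> 'k) set \<Rightarrow> ('a \<times> 'b \<Rightarrow> 'k) set) \<Rightarrow> bool"
  where "is_tensor_bracket K A circ B dia br \<longleftrightarrow>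
    (let T = tensor_space K A B; t = pure_tensor K A B in
      bilinear_map K T T T br \<and>
      (\<forall>a1\<in>carrier A. \<forall>a2\<in>carrier A. \<forall>b1\<in>carrier B. \<forall>b2\<in>carrier B.
        br (t a1 b1) (t a2 b2) =
          t (circ a1 a2) (dia b1 b2) \<ominus>\<^bsub>T\<^esub> t (circ a2 a1) (dia b2 b1)))"

definition is_tensor_mult ::
  "('k, 'r) ring_scheme \<Rightarrow> ('k, 'a, 'm) module_scheme \<Rightarrow> ('a \<Rightarrow> 'a \<Rightarrow> 'a) \<Rightarrow>
   ('k, 'b, 'n) module_scheme \<Rightarrow> ('b \<Rightarrow> 'b \<Rightarrow> 'b) \<Rightarrow>
   (('a \<times> 'b \<Rightarrow> 'k) set \<Rightarrow> ('a \<times> 'b \<Rightarrow> 'k) set \<Rightarrow> ('a \<times> 'b \<Rightarrow> 'k) set) \<Rightarrow> bool"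
  where "is_tensor_mult K A ast B dia mul \<longleftrightarrow>
    (let T = tensor_space K A B; t = pure_tensor K A B in
      bilinear_map K T T T mul \<and>
      (\<forall>a1\<in>carrier A. \<forall>a2\<in>carrier A. \<forall>b1\<in>carrier B. \<forall>b2\<in>carrier B.
        mul (t a1 b1) (t a2 b2) =
          t (ast a1 a2) (dia b1 b2) \<oplus>\<^bsub>T\<^esub> t (ast a2 a1) (dia b2 b1)))"

end

theory Submission
  imports Defs
begin

text \<open>
  An associative product with \<open>(b\<^sub>1 \<diamondop> b\<^sub>2) \<diamondop> b\<^sub>3 = (b\<^sub>2 \<diamondop> b\<^sub>1) \<diamondop> b\<^sub>3\<close> makes every product of
  \<open>b\<^sub>1, b\<^sub>2, b\<^sub>3\<close>, in any order and bracketing, depend on its last factor only. Associativity,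
  the Jacobi identity and the Leibniz rule, evaluated on pure tensors, therefore each split into
  three identities in \<open>A\<close>, one for each possible last factor, and these are instances of the
  pre-Poisson axioms. Bilinear maps on the tensor
  product are obtained by applying its universal property in one argument at a time, and the
  axioms pass from pure tensors to all tensors by multilinearity.
\<close>

section \<open>Linear and bilinear maps\<close>

definition linear_map ::
  "('k, 'r) ring_scheme \<Rightarrow> ('k, 'u, 'm) module_scheme \<Rightarrow> ('k, 'w, 'p) module_scheme \<Rightarrow> ('u \<Rightarrow> 'w) \<Rightarrow> bool"
  where "linear_map K U W h \<longleftrightarrow>
    (\<forall>u\<in>carrier U. h u \<in> carrier W) \<and>
    (\<forall>u\<in>carrier U. \<forall>u'\<in>carrier U. h (u \<oplus>\<^bsub>U\<^esub> u') = h u \<oplus>\<^bsub>W\<^esub> h u') \<and>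
    (\<forall>c\<in>carrier K. \<forall>u\<in>carrier U. h (c \<odot>\<^bsub>U\<^esub> u) = c \<odot>\<^bsub>W\<^esub> h u)"

lemma linear_mapI:
  assumes "\<And>u. u \<in> carrier U \<Longrightarrow> h u \<in> carrier W"
    and "\<And>u u'. \<lbrakk>u \<in> carrier U; u' \<in> carrier U\<rbrakk> \<Longrightarrow> h (u \<oplus>\<^bsub>U\<^esub> u') = h u \<oplus>\<^bsub>W\<^esub> h u'"
    and "\<And>c u. \<lbrakk>c \<in> carrier K; u \<in> carrier U\<rbrakk> \<Longrightarrow> h (c \<odot>\<^bsub>U\<^esub> u) = c \<odot>\<^bsub>W\<^esub> h u"
  shows "linear_map K U W h"
  using assms unfolding linear_map_def by blast

lemma linear_mapD:
  assumes "linear_map K U W h"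
  shows "u \<in> carrier U \<Longrightarrow> h u \<in> carrier W"
    and "\<lbrakk>u \<in> carrier U; u' \<in> carrier U\<rbrakk> \<Longrightarrow> h (u \<oplus>\<^bsub>U\<^esub> u') = h u \<oplus>\<^bsub>W\<^esub> h u'"
    and "\<lbrakk>c \<in> carrier K; u \<in> carrier U\<rbrakk> \<Longrightarrow> h (c \<odot>\<^bsub>U\<^esub> u) = c \<odot>\<^bsub>W\<^esub> h u"
  using assms unfolding linear_map_def by blast+

text \<open>Freezing one argument at a time reduces bilinearity to linearity, so closure properties
  of linear maps carry over to bilinear ones without a separate computation.\<close>

lemma bilinear_map_iff:
  "bilinear_map K U V W f \<longleftrightarrow>
    (\<forall>v\<in>carrier V. linear_map K U W (\<lambda>u. f u v)) \<and> (\<forall>u\<in>carrier U. linear_map K V W (f u))"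
  unfolding bilinear_map_def linear_map_def by blast

lemma bilinear_mapD:
  assumes "bilinear_map K U V W f"
  shows "v \<in> carrier V \<Longrightarrow> linear_map K U W (\<lambda>u. f u v)"
    and "u \<in> carrier U \<Longrightarrow> linear_map K V W (f u)"
  using assms unfolding bilinear_map_iff by blast+

lemma linear_map_compose:
  assumes "linear_map K U V h" "linear_map K V W g"
  shows "linear_map K U W (\<lambda>u. g (h u))"
  using assms unfolding linear_map_def by auto

context module
begin

lemma linear_map_add:
  assumes "linear_map R U M h" "linear_map R U M g"
  shows "linear_map R U M (\<lambda>u. h u \<oplus>\<^bsub>M\<^esub> g u)"
  using assms unfolding linear_map_def by (simp add: M.a_ac smult_r_distr)

lemma linear_map_smult:
  assumes "linear_map R U M h" "c \<in> carrier R"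
  shows "linear_map R U M (\<lambda>u. c \<odot>\<^bsub>M\<^esub> h u)"
  using assms unfolding linear_map_def
  by (simp add: smult_r_distr smult_assoc1[symmetric] R.m_comm)

lemma linear_map_minus:
  assumes "linear_map R U M h" "linear_map R U M g"
  shows "linear_map R U M (\<lambda>u. h u \<ominus>\<^bsub>M\<^esub> g u)"
  using assms unfolding linear_map_def
  by (auto simp add: M.minus_eq M.minus_add M.a_ac smult_r_distr smult_r_minus)

lemma linear_map_const_zero: "linear_map R U M (\<lambda>u. \<zero>\<^bsub>M\<^esub>)"
  unfolding linear_map_def by simp

lemma linear_map_zero:
  assumes "linear_map R M W h" "module R W"
  shows "h \<zero>\<^bsub>M\<^esub> = \<zero>\<^bsub>W\<^esub>"
  using linear_mapD(1)[OF assms(1), of "\<zero>\<^bsub>M\<^esub>"] linear_mapD(3)[OF assms(1), of "\<zero>" "\<zero>\<^bsub>M\<^esub>"]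
    module.smult_l_null[OF assms(2)] by simp

lemma linear_map_a_minus:
  assumes h: "linear_map R M W h" and W: "module R W" and xy: "x \<in> carrier M" "y \<in> carrier M"
  shows "h (x \<ominus>\<^bsub>M\<^esub> y) = h x \<ominus>\<^bsub>W\<^esub> h y"
proof -
  interpret W: module R W by (fact W)
  \<comment> \<open>Linearity speaks of sums and scalar multiples only, so negation is passed
    through \<open>h\<close> as multiplication by the scalar -1.\<close>
  have m: "\<ominus>\<^bsub>M\<^esub> y = (\<ominus> \<one>) \<odot>\<^bsub>M\<^esub> y" using xy by (simp add: smult_l_minus)
  have hy: "h y \<in> carrier W" using linear_mapD(1)[OF h] xy by simp
  have "h (\<ominus>\<^bsub>M\<^esub> y) = (\<ominus> \<one>) \<odot>\<^bsub>W\<^esub> h y"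
    unfolding m using xy by (simp add: linear_mapD(3)[OF h])
  then have "h (\<ominus>\<^bsub>M\<^esub> y) = \<ominus>\<^bsub>W\<^esub> h y" using hy by (simp add: W.smult_l_minus)
  then show ?thesis using xy by (simp add: M.minus_eq W.minus_eq linear_mapD(2)[OF h])
qed

text \<open>Serves two purposes: linear maps that agree on generators agree everywhere, and with the
  zero map for \<open>g\<close> the kernel of \<open>h\<close> is a submodule.\<close>

lemma submodule_equalizer:
  assumes h: "linear_map R M W h" and g: "linear_map R M W g" and W: "module R W"
  shows "submodule {x \<in> carrier M. h x = g x} R M"
proof (rule submoduleI)
  fix a assume "a \<in> {x \<in> carrier M. h x = g x}"
  then show "\<ominus>\<^bsub>M\<^esub> a \<in> {x \<in> carrier M. h x = g x}"
    using linear_map_a_minus[OF h W, of "\<zero>\<^bsub>M\<^esub>" a] linear_map_a_minus[OF g W, of "\<zero>\<^bsub>M\<^esub>" a]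
      linear_map_zero[OF h W] linear_map_zero[OF g W]
    by (simp add: M.minus_eq)
qed (auto simp: linear_mapD(2,3)[OF h] linear_mapD(2,3)[OF g] linear_map_zero[OF h W]
      linear_map_zero[OF g W])

end

lemma linear_map_id: "linear_map K U U (\<lambda>u. u)"
  by (rule linear_mapI) auto

lemma linear_map_bilinear:
  assumes "bilinear_map K U V W \<beta>"
  shows "linear_map K X U h \<Longrightarrow> v \<in> carrier V \<Longrightarrow> linear_map K X W (\<lambda>x. \<beta> (h x) v)"
    and "linear_map K X V g \<Longrightarrow> u \<in> carrier U \<Longrightarrow> linear_map K X W (\<lambda>x. \<beta> u (g x))"
  by (erule linear_map_compose, erule bilinear_mapD[OF assms])+

lemma bilinear_map_closed:
  "bilinear_map K U V W \<beta> \<Longrightarrow> u \<in> carrier U \<Longrightarrow> v \<in> carrier V \<Longrightarrow> \<beta> u v \<in> carrier W"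
  unfolding bilinear_map_def by blast

lemma bilinear_map_distrib:
  assumes "bilinear_map K U V W \<beta>" "u \<in> carrier U" "v \<in> carrier V"
  shows "u' \<in> carrier U \<Longrightarrow> \<beta> (u \<oplus>\<^bsub>U\<^esub> u') v = \<beta> u v \<oplus>\<^bsub>W\<^esub> \<beta> u' v"
    and "v' \<in> carrier V \<Longrightarrow> \<beta> u (v \<oplus>\<^bsub>V\<^esub> v') = \<beta> u v \<oplus>\<^bsub>W\<^esub> \<beta> u v'"
  using assms by (simp_all add: bilinear_map_def)

lemma bilinear_map_swap: "bilinear_map K U V W \<beta> \<Longrightarrow> bilinear_map K V U W (\<lambda>v u. \<beta> u v)"
  unfolding bilinear_map_iff by blast

lemma (in module) bilinear_map_add:
  assumes "bilinear_map R U V M \<beta>" "bilinear_map R U V M \<gamma>"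
  shows "bilinear_map R U V M (\<lambda>u v. \<beta> u v \<oplus>\<^bsub>M\<^esub> \<gamma> u v)"
  using assms by (simp add: bilinear_map_iff linear_map_add)

lemma (in module) bilinear_map_minus:
  assumes "bilinear_map R U V M \<beta>" "bilinear_map R U V M \<gamma>"
  shows "bilinear_map R U V M (\<lambda>u v. \<beta> u v \<ominus>\<^bsub>M\<^esub> \<gamma> u v)"
  using assms by (simp add: bilinear_map_iff linear_map_minus)

lemma bilinear_map_a_minus:
  assumes \<beta>: "bilinear_map K U V W \<beta>" and "module K U" "module K V" "module K W"
    and "u \<in> carrier U" "v \<in> carrier V"
  shows "u' \<in> carrier U \<Longrightarrow> \<beta> (u \<ominus>\<^bsub>U\<^esub> u') v = \<beta> u v \<ominus>\<^bsub>W\<^esub> \<beta> u' v"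
    and "v' \<in> carrier V \<Longrightarrow> \<beta> u (v \<ominus>\<^bsub>V\<^esub> v') = \<beta> u v \<ominus>\<^bsub>W\<^esub> \<beta> u v'"
  by (rule module.linear_map_a_minus[OF assms(2) bilinear_mapD(1)[OF \<beta> assms(6)] assms(4,5)],
      assumption,
      rule module.linear_map_a_minus[OF assms(3) bilinear_mapD(2)[OF \<beta> assms(5)] assms(4,6)],
      assumption)

text \<open>Needed to replace a bilinear map by its restriction to the carriers. The module
  hypotheses ensure that sums and scalar multiples stay where the two functions agree.\<close>

lemma bilinear_map_cong:
  assumes "\<And>u v. u \<in> carrier U \<Longrightarrow> v \<in> carrier V \<Longrightarrow> f u v = g u v" "module K U" "module K V"
  shows "bilinear_map K U V W f \<longleftrightarrow> bilinear_map K U V W g"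
proof -
  interpret U: module K U by (fact assms)
  interpret V: module K V by (fact assms)
  show ?thesis unfolding bilinear_map_def using assms(1) by auto
qed

section \<open>Differences in abelian groups\<close>

context abelian_group
begin

text \<open>Rules (1) and (2) collect an expanded identity into a single difference of two sums;
  rule (3) cancels a common summand in the next lemma.\<close>

lemma minus_minus_interchange:
  assumes "a \<in> carrier G" "b \<in> carrier G" "c \<in> carrier G" "d \<in> carrier G"
  shows "(a \<ominus> b) \<ominus> (c \<ominus> d) = (a \<oplus> d) \<ominus> (b \<oplus> c)"
    and "(a \<ominus> b) \<oplus> (c \<ominus> d) = (a \<oplus> c) \<ominus> (b \<oplus> d)"
    and "(a \<oplus> b) \<ominus> (c \<oplus> d) = (a \<ominus> c) \<oplus> (b \<ominus> d)"
  using assms by (simp_all add: minus_eq minus_add a_ac)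

text \<open>Removes subtraction, so that what remains can be settled by reordering summands.\<close>

lemma minus_eq_minus_iff:
  assumes "a \<in> carrier G" "b \<in> carrier G" "c \<in> carrier G" "d \<in> carrier G"
  shows "a \<ominus> b = c \<ominus> d \<longleftrightarrow> a \<oplus> d = c \<oplus> b"
proof
  assume "a \<ominus> b = c \<ominus> d"
  then have "(a \<ominus> b) \<oplus> (b \<oplus> d) = (c \<ominus> d) \<oplus> (b \<oplus> d)" by simp
  moreover have "(a \<ominus> b) \<oplus> (b \<oplus> d) = a \<oplus> d"
    using assms by (simp add: minus_eq a_assoc r_neg1)
  moreover have "(c \<ominus> d) \<oplus> (b \<oplus> d) = c \<oplus> b"
    using assms by (simp add: minus_eq a_assoc r_neg1 a_comm[of b d])
  ultimately show "a \<oplus> d = c \<oplus> b" by simp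
next
  assume *: "a \<oplus> d = c \<oplus> b"
  have "a \<ominus> b = (a \<oplus> d) \<ominus> (b \<oplus> d)"
    using assms by (simp add: minus_minus_interchange(3)) (simp add: minus_eq r_neg)
  also have "\<dots> = (c \<oplus> b) \<ominus> (d \<oplus> b)" using assms * by (simp add: a_comm)
  also have "\<dots> = c \<ominus> d"
    using assms by (simp add: minus_minus_interchange(3)) (simp add: minus_eq r_neg)
  finally show "a \<ominus> b = c \<ominus> d" .
qed

lemma minus_eq_zero_iff:
  assumes "a \<in> carrier G" "b \<in> carrier G"
  shows "a \<ominus> b = \<zero> \<longleftrightarrow> a = b"
proof -
  have "\<zero> \<ominus> \<zero> = \<zero>" by (metis minus_eq r_neg zero_closed)
  then show ?thesis using minus_eq_minus_iff[of a b "\<zero>" "\<zero>"] assms by simp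
qed

end

text \<open>In characteristic zero 2 is a nonzero scalar, hence invertible, and can be cancelled.
  This is what turns anticommutativity of the bracket into the alternating law.\<close>

lemma (in vspace) add_self_eq_zero:
  assumes x: "x \<in> carrier V" and xx: "x \<oplus>\<^bsub>V\<^esub> x = \<zero>\<^bsub>V\<^esub>"
  shows "x = \<zero>\<^bsub>V\<^esub>"
proof -
  have two: "\<one> \<oplus> \<one> \<in> carrier K" "\<one> \<oplus> \<one> \<noteq> \<zero>"
    using char_zero[of 2] by (simp_all add: numeral_2_eq_2 add_pow_def)
  then have u: "\<one> \<oplus> \<one> \<in> Units K" by (simp add: field_Units)
  have "(\<one> \<oplus> \<one>) \<odot>\<^bsub>V\<^esub> x = \<zero>\<^bsub>V\<^esub>" using x xx by (simp add: smult_l_distr)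
  then have "inv (\<one> \<oplus> \<one>) \<odot>\<^bsub>V\<^esub> ((\<one> \<oplus> \<one>) \<odot>\<^bsub>V\<^esub> x) = \<zero>\<^bsub>V\<^esub>" using u by simp
  then show ?thesis using u x by (simp add: smult_assoc1[symmetric])
qed

section \<open>Free modules and quotient modules\<close>

lemma free_module_simps [simp]:
  "zero (free_module K X) = (\<lambda>_. \<zero>\<^bsub>K\<^esub>)"
  "add (free_module K X) = (\<lambda>f g x. f x \<oplus>\<^bsub>K\<^esub> g x)"
  "smult (free_module K X) = (\<lambda>c f x. c \<otimes>\<^bsub>K\<^esub> f x)"
  by (simp_all add: free_module_def)

lemma carrier_free_module:
  "f \<in> carrier (free_module K X) \<longleftrightarrow>
    (\<forall>x. f x \<in> carrier K) \<and> (\<forall>x. x \<notin> X \<longrightarrow> f x = \<zero>\<^bsub>K\<^esub>) \<and> finite {x. f x \<noteq> \<zero>\<^bsub>K\<^esub>}"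
  by (simp add: free_module_def)

context cring
begin

lemma free_module_is_module: "module R (free_module R X)"
proof (rule moduleI)
  show "cring R" by (rule is_cring)
  have add: "(\<lambda>x. f x \<oplus> g x) \<in> carrier (free_module R X)"
    if "f \<in> carrier (free_module R X)" "g \<in> carrier (free_module R X)" for f g
  proof -
    have "{x. f x \<oplus> g x \<noteq> \<zero>} \<subseteq> {x. f x \<noteq> \<zero>} \<union> {x. g x \<noteq> \<zero>}" by auto
    then show ?thesis using that unfolding carrier_free_module
      by (auto intro: finite_subset)
  qed
  show smult: "c \<odot>\<^bsub>free_module R X\<^esub> f \<in> carrier (free_module R X)"
    if "c \<in> carrier R" "f \<in> carrier (free_module R X)" for c f
  proof -
    have "{x. c \<otimes> f x \<noteq> \<zero>} \<subseteq> {x. f x \<noteq> \<zero>}" using that by auto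
    then show ?thesis using that unfolding carrier_free_module
      by (auto intro: finite_subset)
  qed
  show "abelian_group (free_module R X)"
  proof (rule abelian_groupI)
    fix f assume f: "f \<in> carrier (free_module R X)"
    \<comment> \<open>Taking the inverse to be -1 times \<open>f\<close> gives its finite support
      from closure under scalar multiplication.\<close>
    have "(\<ominus> \<one>) \<odot>\<^bsub>free_module R X\<^esub> f \<in> carrier (free_module R X)" by (rule smult) (use f in auto)
    moreover have "(\<ominus> \<one>) \<odot>\<^bsub>free_module R X\<^esub> f \<oplus>\<^bsub>free_module R X\<^esub> f = \<zero>\<^bsub>free_module R X\<^esub>"
      using f by (auto simp: carrier_free_module l_minus l_neg)
    ultimately show "\<exists>g\<in>carrier (free_module R X). g \<oplus>\<^bsub>free_module R X\<^esub> f = \<zero>\<^bsub>free_module R X\<^esub>"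
      by blast
  qed (use add in \<open>auto simp: carrier_free_module a_ac\<close>)
qed (auto simp: carrier_free_module l_distr r_distr m_assoc)

lemma free_gen_closed: "x \<in> X \<Longrightarrow> free_gen R x \<in> carrier (free_module R X)"
  by (auto simp: carrier_free_module free_gen_def)

text \<open>A function of finite support is a finite combination of generators; the proof removes
  one point of the support at a time.\<close>

lemma free_module_generated:
  assumes N: "submodule N R (free_module R X)" and gen: "\<And>x. x \<in> X \<Longrightarrow> free_gen R x \<in> N"
    and f: "f \<in> carrier (free_module R X)"
  shows "f \<in> N"
proof -
  interpret F: module R "free_module R X" by (rule free_module_is_module)
  note NE = F.submoduleE[OF N]
  \<comment> \<open>The induction runs over a finite set containing the support, with
    \<open>f\<close> quantified inside, because the step passes from \<open>f\<close> to
    \<open>f(x := \<zero>)\<close>.\<close>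
  have "\<forall>f. f \<in> carrier (free_module R X) \<and> {x. f x \<noteq> \<zero>} \<subseteq> S \<longrightarrow> f \<in> N" if "finite S" for S
    using that
  proof induction
    case empty
    obtain n where n: "n \<in> N" using NE(2) by blast
    then have "n \<in> carrier (free_module R X)" using NE(1) by blast
    then have "\<zero> \<odot>\<^bsub>free_module R X\<^esub> n = (\<lambda>_. \<zero>)" by (auto simp: carrier_free_module)
    then have "(\<lambda>_. \<zero>) \<in> N" using NE(4)[OF zero_closed n] by simp
    moreover have "f = (\<lambda>_. \<zero>)" if "{x. f x \<noteq> \<zero>} \<subseteq> {}" for f :: "'b \<Rightarrow> 'a"
      using that by auto
    ultimately show ?case by simp
  next
    case (insert x S)
    show ?case
    proof (intro allI impI, elim conjE)
      fix f assume f: "f \<in> carrier (free_module R X)" and supp: "{x. f x \<noteq> \<zero>} \<subseteq> insert x S"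
      have "f(x := \<zero>) \<in> carrier (free_module R X)"
        using f by (auto simp: carrier_free_module intro: finite_subset[rotated])
      moreover have "{y. (f(x := \<zero>)) y \<noteq> \<zero>} \<subseteq> S" using supp by auto
      ultimately have rest: "f(x := \<zero>) \<in> N" using insert.IH by blast
      show "f \<in> N"
      proof (cases "x \<in> X")
        case True
        \<comment> \<open>Split off the coordinate at \<open>x\<close>.\<close>
        have "f = f x \<odot>\<^bsub>free_module R X\<^esub> free_gen R x \<oplus>\<^bsub>free_module R X\<^esub> f(x := \<zero>)"
          using f by (auto simp: free_gen_def carrier_free_module)
        moreover have "f x \<in> carrier R" using f by (auto simp: carrier_free_module)
        ultimately show ?thesis using NE(4)[OF _ gen[OF True]] NE(5) rest by metis
      next
        case False
        \<comment> \<open>\<open>S\<close> may leave \<open>X\<close>; at such a point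
          \<open>f\<close> already vanishes and nothing has to be split off.\<close>
        then have "f(x := \<zero>) = f" using f by (auto simp: carrier_free_module)
        then show ?thesis using rest by simp
      qed
    qed
  qed
  moreover have "finite {x. f x \<noteq> \<zero>}" using f by (simp add: carrier_free_module)
  ultimately show ?thesis using f by blast
qed

end

section \<open>Universal property of free modules\<close>

context module
begin

lemma free_module_lift:
  assumes \<phi>: "\<And>x. x \<in> X \<Longrightarrow> \<phi> x \<in> carrier M"
  obtains h where "linear_map R (free_module R X) M h" "\<And>x. x \<in> X \<Longrightarrow> h (free_gen R x) = \<phi> x"
proof
  define h where "h f = (\<Oplus>\<^bsub>M\<^esub>x\<in>{x. f x \<noteq> \<zero>}. f x \<odot>\<^bsub>M\<^esub> \<phi> x)" for f
  let ?F = "free_module R X"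
  have term_closed: "f x \<odot>\<^bsub>M\<^esub> \<phi> x \<in> carrier M" if "f \<in> carrier ?F" "x \<in> X" for f x
    using that \<phi> by (auto simp: carrier_free_module)
  \<comment> \<open>The support of a sum can be smaller than the union of the supports, and that of
    a multiple smaller than the original one. Summing over any larger finite set gives the values of
    \<open>h\<close> a common index set.\<close>
  have h_eq: "h f = (\<Oplus>\<^bsub>M\<^esub>x\<in>S. f x \<odot>\<^bsub>M\<^esub> \<phi> x)"
    if "f \<in> carrier ?F" "finite S" "{x. f x \<noteq> \<zero>} \<subseteq> S" "S \<subseteq> X" for f S
    unfolding h_def
    by (rule M.add.finprod_mono_neutral_cong_left)
      (use that \<phi> in \<open>auto simp: subset_iff intro!: term_closed\<close>)
  have supp: "finite {x. f x \<noteq> \<zero>}" "{x. f x \<noteq> \<zero>} \<subseteq> X" if "f \<in> carrier ?F" for f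
    using that by (auto simp: carrier_free_module)
  interpret F: module R ?F by (rule R.free_module_is_module)
  show "linear_map R ?F M h"
  proof (rule linear_mapI)
    fix f assume f: "f \<in> carrier ?F"
    show "h f \<in> carrier M" unfolding h_def
      by (rule M.finsum_closed) (use supp(2)[OF f] term_closed[OF f] in auto)
    fix g assume g: "g \<in> carrier ?F"
    let ?S = "{x. f x \<noteq> \<zero>} \<union> {x. g x \<noteq> \<zero>}"
    have S: "finite ?S" "?S \<subseteq> X" using supp[OF f] supp[OF g] by auto
    have fg: "f \<oplus>\<^bsub>?F\<^esub> g \<in> carrier ?F" by (rule F.a_closed[OF f g])
    have "h (f \<oplus>\<^bsub>?F\<^esub> g) = (\<Oplus>\<^bsub>M\<^esub>x\<in>?S. (f \<oplus>\<^bsub>?F\<^esub> g) x \<odot>\<^bsub>M\<^esub> \<phi> x)"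
      by (rule h_eq[OF fg S(1) _ S(2)]) auto
    also have "\<dots> = (\<Oplus>\<^bsub>M\<^esub>x\<in>?S. f x \<odot>\<^bsub>M\<^esub> \<phi> x \<oplus>\<^bsub>M\<^esub> g x \<odot>\<^bsub>M\<^esub> \<phi> x)"
    proof (rule M.finsum_cong')
      fix x assume "x \<in> ?S"
      then have x: "x \<in> X" using S(2) by blast
      show "(f \<oplus>\<^bsub>?F\<^esub> g) x \<odot>\<^bsub>M\<^esub> \<phi> x = f x \<odot>\<^bsub>M\<^esub> \<phi> x \<oplus>\<^bsub>M\<^esub> g x \<odot>\<^bsub>M\<^esub> \<phi> x"
        using f g \<phi>[OF x] by (simp add: carrier_free_module smult_l_distr)
    qed (use S(2) term_closed[OF f] term_closed[OF g] in auto)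
    also have "\<dots> = (\<Oplus>\<^bsub>M\<^esub>x\<in>?S. f x \<odot>\<^bsub>M\<^esub> \<phi> x) \<oplus>\<^bsub>M\<^esub> (\<Oplus>\<^bsub>M\<^esub>x\<in>?S. g x \<odot>\<^bsub>M\<^esub> \<phi> x)"
      by (rule M.finsum_addf) (use S(2) term_closed[OF f] term_closed[OF g] in auto)
    also have "\<dots> = h f \<oplus>\<^bsub>M\<^esub> h g"
      using h_eq[OF f S(1) _ S(2)] h_eq[OF g S(1) _ S(2)] by simp
    finally show "h (f \<oplus>\<^bsub>?F\<^esub> g) = h f \<oplus>\<^bsub>M\<^esub> h g" .
  next
    fix c f assume c: "c \<in> carrier R" and f: "f \<in> carrier ?F"
    let ?S = "{x. f x \<noteq> \<zero>}"
    have cf: "c \<odot>\<^bsub>?F\<^esub> f \<in> carrier ?F" by (rule F.smult_closed[OF c f])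
    have "h (c \<odot>\<^bsub>?F\<^esub> f) = (\<Oplus>\<^bsub>M\<^esub>x\<in>?S. (c \<odot>\<^bsub>?F\<^esub> f) x \<odot>\<^bsub>M\<^esub> \<phi> x)"
      by (rule h_eq[OF cf supp(1)[OF f] _ supp(2)[OF f]]) (use c in auto)
    also have "\<dots> = (\<Oplus>\<^bsub>M\<^esub>x\<in>?S. c \<odot>\<^bsub>M\<^esub> (f x \<odot>\<^bsub>M\<^esub> \<phi> x))"
    proof (rule M.finsum_cong')
      fix x assume "x \<in> ?S"
      then have x: "x \<in> X" using supp(2)[OF f] by blast
      show "(c \<odot>\<^bsub>?F\<^esub> f) x \<odot>\<^bsub>M\<^esub> \<phi> x = c \<odot>\<^bsub>M\<^esub> (f x \<odot>\<^bsub>M\<^esub> \<phi> x)"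
        using c f \<phi>[OF x] by (simp add: carrier_free_module smult_assoc1)
    qed (use supp(2)[OF f] term_closed[OF f] c in auto)
    also have "\<dots> = c \<odot>\<^bsub>M\<^esub> h f" unfolding h_def
      by (rule finsum_smult_ldistr[symmetric])
        (use supp[OF f] term_closed[OF f] c in auto)
    finally show "h (c \<odot>\<^bsub>?F\<^esub> f) = c \<odot>\<^bsub>M\<^esub> h f" .
  qed
  fix x assume x: "x \<in> X"
  have "h (free_gen R x) = (\<Oplus>\<^bsub>M\<^esub>y\<in>{x}. free_gen R x y \<odot>\<^bsub>M\<^esub> \<phi> y)"
    by (rule h_eq[OF R.free_gen_closed[OF x]]) (use x in \<open>auto simp: free_gen_def\<close>)
  also have "\<dots> = \<phi> x"
    using M.finsum_insert[of "{}" x "\<lambda>y. free_gen R x y \<odot>\<^bsub>M\<^esub> \<phi> y"] \<phi>[OF x]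
    by (simp add: free_gen_def)
  finally show "h (free_gen R x) = \<phi> x" .
qed

end

section \<open>Quotient modules\<close>

lemma quot_module_simps [simp]:
  "carrier (quot_module M N) = a_rcosets\<^bsub>M\<^esub> N"
  "zero (quot_module M N) = N"
  "add (quot_module M N) = (\<lambda>C D. C <+>\<^bsub>M\<^esub> D)"
  by (simp_all add: quot_module_def)

context module
begin

lemma submodule_abelian_subgroup:
  assumes "submodule N R M"
  shows "abelian_subgroup N M"
  by (rule abelian_subgroupI3)
    (use assms in \<open>auto simp: additive_subgroup_def submodule_def M.abelian_group_axioms\<close>)

lemma submodule_gen_submodule:
  assumes "S \<subseteq> carrier M"
  shows "submodule (submodule_gen R M S) R M"
proof (rule submoduleI)
  show "submodule_gen R M S \<subseteq> carrier M"
    \<comment> \<open>The whole module is a member of the intersected family, which keeps the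
      intersection inside the carrier.\<close>
    unfolding submodule_gen_def using assms carrier_is_submodule by blast
  show "\<zero>\<^bsub>M\<^esub> \<in> submodule_gen R M S"
    unfolding submodule_gen_def
    using abelian_subgroup.axioms(1)[OF submodule_abelian_subgroup] additive_subgroup.zero_closed
    by blast
qed (auto simp: submodule_gen_def dest: submoduleE)

lemma submodule_gen_incl: "S \<subseteq> submodule_gen R M S"
  unfolding submodule_gen_def by blast

lemma submodule_gen_least: "submodule N R M \<Longrightarrow> S \<subseteq> N \<Longrightarrow> submodule_gen R M S \<subseteq> N"
  unfolding submodule_gen_def by blast

context
  fixes N
  assumes N: "submodule N R M"
begin

lemma carrier_quot_module: "C \<in> carrier (quot_module M N) \<longleftrightarrow> (\<exists>x\<in>carrier M. C = N +>\<^bsub>M\<^esub> x)"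
  by (auto simp: A_RCOSETS_def')

lemma quot_module_add:
  assumes "x \<in> carrier M" "y \<in> carrier M"
  shows "(N +>\<^bsub>M\<^esub> x) \<oplus>\<^bsub>quot_module M N\<^esub> (N +>\<^bsub>M\<^esub> y) = N +>\<^bsub>M\<^esub> (x \<oplus>\<^bsub>M\<^esub> y)"
  using abelian_subgroup.a_rcos_sum[OF submodule_abelian_subgroup[OF N] assms] by simp

text \<open>Scalar multiplication is encoded as a union over all representatives. Replacing the
  representative changes the product by an element of \<open>N\<close>, so every member of the union
  is the same coset.\<close>

lemma quot_module_smult:
  assumes c: "c \<in> carrier R" and x: "x \<in> carrier M"
  shows "c \<odot>\<^bsub>quot_module M N\<^esub> (N +>\<^bsub>M\<^esub> x) = N +>\<^bsub>M\<^esub> (c \<odot>\<^bsub>M\<^esub> x)"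
proof -
  interpret N: abelian_subgroup N M by (rule submodule_abelian_subgroup[OF N])
  have "N +>\<^bsub>M\<^esub> (c \<odot>\<^bsub>M\<^esub> y) = N +>\<^bsub>M\<^esub> (c \<odot>\<^bsub>M\<^esub> x)" if "y \<in> N +>\<^bsub>M\<^esub> x" for y
  proof -
    obtain n where n: "n \<in> N" "y = n \<oplus>\<^bsub>M\<^esub> x" using \<open>y \<in> N +>\<^bsub>M\<^esub> x\<close> by (auto simp: a_r_coset_def')
    have "c \<odot>\<^bsub>M\<^esub> y = c \<odot>\<^bsub>M\<^esub> n \<oplus>\<^bsub>M\<^esub> c \<odot>\<^bsub>M\<^esub> x"
      using n c x N.a_subset by (auto simp: smult_r_distr)
    moreover have "c \<odot>\<^bsub>M\<^esub> n \<in> N" using submoduleE(4)[OF N c n(1)] .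
    ultimately have "c \<odot>\<^bsub>M\<^esub> y \<in> N +>\<^bsub>M\<^esub> (c \<odot>\<^bsub>M\<^esub> x)" by (auto simp: a_r_coset_def')
    then show ?thesis using N.a_repr_independence'[of "c \<odot>\<^bsub>M\<^esub> y" "c \<odot>\<^bsub>M\<^esub> x"] c x by auto
  qed
  then have "(\<Union>y\<in>N +>\<^bsub>M\<^esub> x. N +>\<^bsub>M\<^esub> (c \<odot>\<^bsub>M\<^esub> y)) = (\<Union>y\<in>N +>\<^bsub>M\<^esub> x. N +>\<^bsub>M\<^esub> (c \<odot>\<^bsub>M\<^esub> x))"
    by (rule SUP_cong[OF refl])
  \<comment> \<open>A union of equal sets collapses to that set only over a nonempty index.\<close>
  moreover have "N +>\<^bsub>M\<^esub> x \<noteq> {}" using N.a_rcos_self[OF x] by blast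
  ultimately show ?thesis by (simp add: quot_module_def)
qed

lemma quot_module_is_module: "module R (quot_module M N)"
proof -
  interpret N: abelian_subgroup N M by (rule submodule_abelian_subgroup[OF N])
  let ?Q = "quot_module M N"
  \<comment> \<open>With zero written as a coset too, each module axiom becomes the axiom of
    \<open>M\<close> on representatives.\<close>
  have zero: "\<zero>\<^bsub>?Q\<^esub> = N +>\<^bsub>M\<^esub> \<zero>\<^bsub>M\<^esub>" using N.a_subset by simp
  have ab: "abelian_group ?Q"
  proof (rule abelian_groupI)
    fix C assume "C \<in> carrier ?Q"
    then obtain x where "x \<in> carrier M" "C = N +>\<^bsub>M\<^esub> x" unfolding carrier_quot_module by blast
    then show "\<exists>D\<in>carrier ?Q. D \<oplus>\<^bsub>?Q\<^esub> C = \<zero>\<^bsub>?Q\<^esub>"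
      unfolding zero
      by (intro bexI[of _ "N +>\<^bsub>M\<^esub> (\<ominus>\<^bsub>M\<^esub> x)"])
        (auto simp only: quot_module_add carrier_quot_module M.l_neg M.a_inv_closed)
  qed (auto simp only: carrier_quot_module quot_module_add zero M.a_closed M.zero_closed
      M.l_zero M.r_zero M.a_ac)
  show ?thesis
  proof (rule moduleI)
    show "cring R" by (rule R.is_cring)
    show "abelian_group ?Q" by (rule ab)
  qed (auto simp only: carrier_quot_module quot_module_smult quot_module_add smult_closed M.a_closed
      smult_l_distr smult_r_distr smult_assoc1 smult_one R.a_closed R.m_closed R.one_closed)
qed

lemma quot_module_proj: "linear_map R M (quot_module M N) (\<lambda>x. N +>\<^bsub>M\<^esub> x)"
  by (rule linear_mapI) (auto simp only: carrier_quot_module quot_module_smult quot_module_add)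

lemma quot_module_lift:
  assumes W: "module R W" and h: "linear_map R M W h" and ker: "\<And>n. n \<in> N \<Longrightarrow> h n = \<zero>\<^bsub>W\<^esub>"
  obtains g where "linear_map R (quot_module M N) W g"
    "\<And>x. x \<in> carrier M \<Longrightarrow> g (N +>\<^bsub>M\<^esub> x) = h x"
proof
  interpret N: abelian_subgroup N M by (rule submodule_abelian_subgroup[OF N])
  interpret W: module R W by (fact W)
  \<comment> \<open>An arbitrary representative will do: any two differ by an element of
    \<open>N\<close>, which \<open>h\<close> sends to zero.\<close>
  define g where "g C = h (SOME x. x \<in> C)" for C
  show g: "g (N +>\<^bsub>M\<^esub> x) = h x" if x: "x \<in> carrier M" for x
  proof -
    have "(SOME y. y \<in> N +>\<^bsub>M\<^esub> x) \<in> N +>\<^bsub>M\<^esub> x" using N.a_rcos_self[OF x] by (rule someI)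
    then obtain n where "n \<in> N" "(SOME y. y \<in> N +>\<^bsub>M\<^esub> x) = n \<oplus>\<^bsub>M\<^esub> x"
      by (auto simp: a_r_coset_def')
    then show ?thesis using x N.a_subset ker linear_mapD(1)[OF h x]
      by (auto simp: g_def linear_mapD(2)[OF h] subset_iff)
  qed
  show "linear_map R (quot_module M N) W g"
    by (rule linear_mapI)
      (auto simp only: carrier_quot_module quot_module_smult quot_module_add g linear_mapD[OF h]
        M.a_closed smult_closed)
qed

end

end

section \<open>The universal property of the tensor product\<close>

locale two_modules = A: module K A + B: module K B for K (structure) and A and B
begin

abbreviation (input) "F \<equiv> free_module K (carrier A \<times> carrier B)"
abbreviation (input) "T \<equiv> tensor_space K A B"
abbreviation (input) "t \<equiv> pure_tensor K A B"

sublocale F: module K F by (rule A.R.free_module_is_module)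

lemma gen_closed: "a \<in> carrier A \<Longrightarrow> b \<in> carrier B \<Longrightarrow> free_gen K (a, b) \<in> carrier F"
  by (rule A.R.free_gen_closed) simp

lemma bilinear_relators_closed: "bilinear_relators K A B \<subseteq> carrier F"
  unfolding bilinear_relators_def Let_def
  by (auto simp del: free_module_simps intro!: F.minus_closed F.a_closed F.smult_closed gen_closed)

lemma tensor_null_submodule: "submodule (tensor_null K A B) K F"
  unfolding tensor_null_def by (rule F.submodule_gen_submodule[OF bilinear_relators_closed])

sublocale T: module K T
  unfolding tensor_space_def by (rule F.quot_module_is_module[OF tensor_null_submodule])

lemma tensor_proj: "linear_map K F T (\<lambda>x. tensor_null K A B +>\<^bsub>F\<^esub> x)"
  unfolding tensor_space_def by (rule F.quot_module_proj[OF tensor_null_submodule])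

text \<open>The relators are differences, so this criterion turns each of them into an equation
  between cosets.\<close>

lemma tensor_proj_eqI:
  assumes "x \<in> carrier F" "y \<in> carrier F" "x \<ominus>\<^bsub>F\<^esub> y \<in> tensor_null K A B"
  shows "tensor_null K A B +>\<^bsub>F\<^esub> x = tensor_null K A B +>\<^bsub>F\<^esub> y"
proof -
  interpret N: abelian_subgroup "tensor_null K A B" F
    by (rule F.submodule_abelian_subgroup[OF tensor_null_submodule])
  show ?thesis
    using N.a_repr_independence'[OF N.a_rcos_module_rev[OF assms(2,1)] assms(2)] assms(3)
    by (simp add: F.M.minus_eq del: free_module_simps)
qed

text \<open>The four families of relators are exactly the four bilinearity laws, and the projection
  makes them vanish.\<close>

lemma pure_tensor_bilinear: "bilinear_map K A B T t"
proof -
  note null = subsetD[OF F.submodule_gen_incl[of "bilinear_relators K A B", folded tensor_null_def]]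
  note cl = gen_closed F.a_closed F.smult_closed A.a_closed B.a_closed A.smult_closed B.smult_closed
  show ?thesis
    unfolding bilinear_map_def pure_tensor_def linear_mapD(2,3)[OF tensor_proj, symmetric]
  proof (intro conjI ballI)
    show "tensor_null K A B +>\<^bsub>F\<^esub> free_gen K (a, b) \<in> carrier T"
      if "a \<in> carrier A" "b \<in> carrier B" for a b
      using linear_mapD(1)[OF tensor_proj gen_closed[OF that]] .
  next
    fix a a' b assume *: "a \<in> carrier A" "a' \<in> carrier A" "b \<in> carrier B"
    show "tensor_null K A B +>\<^bsub>F\<^esub> free_gen K (a \<oplus>\<^bsub>A\<^esub> a', b) =
      (tensor_null K A B +>\<^bsub>F\<^esub> free_gen K (a, b)) \<oplus>\<^bsub>T\<^esub> (tensor_null K A B +>\<^bsub>F\<^esub> free_gen K (a', b))"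
      \<comment> \<open>The right side becomes the coset of one element of \<open>F\<close>, so that
        the difference of representatives is literally a relator.\<close>
      unfolding linear_mapD(2)[OF tensor_proj gen_closed[OF *(1,3)] gen_closed[OF *(2,3)], symmetric]
      by (intro tensor_proj_eqI cl null *)
        (use * in \<open>auto simp: bilinear_relators_def Let_def simp del: free_module_simps\<close>)
  next
    fix a b b' assume *: "a \<in> carrier A" "b \<in> carrier B" "b' \<in> carrier B"
    show "tensor_null K A B +>\<^bsub>F\<^esub> free_gen K (a, b \<oplus>\<^bsub>B\<^esub> b') =
      (tensor_null K A B +>\<^bsub>F\<^esub> free_gen K (a, b)) \<oplus>\<^bsub>T\<^esub> (tensor_null K A B +>\<^bsub>F\<^esub> free_gen K (a, b'))"
      unfolding linear_mapD(2)[OF tensor_proj gen_closed[OF *(1,2)] gen_closed[OF *(1,3)], symmetric]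
      by (intro tensor_proj_eqI cl null *)
        (use * in \<open>auto simp: bilinear_relators_def Let_def simp del: free_module_simps\<close>)
  next
    fix c a b assume *: "c \<in> carrier K" "a \<in> carrier A" "b \<in> carrier B"
    show "tensor_null K A B +>\<^bsub>F\<^esub> free_gen K (c \<odot>\<^bsub>A\<^esub> a, b) =
      c \<odot>\<^bsub>T\<^esub> (tensor_null K A B +>\<^bsub>F\<^esub> free_gen K (a, b))"
      unfolding linear_mapD(3)[OF tensor_proj *(1) gen_closed[OF *(2,3)], symmetric]
      by (intro tensor_proj_eqI cl null *)
        (use * in \<open>auto simp: bilinear_relators_def Let_def simp del: free_module_simps\<close>)
    show "tensor_null K A B +>\<^bsub>F\<^esub> free_gen K (a, c \<odot>\<^bsub>B\<^esub> b) =
      c \<odot>\<^bsub>T\<^esub> (tensor_null K A B +>\<^bsub>F\<^esub> free_gen K (a, b))"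
      unfolding linear_mapD(3)[OF tensor_proj *(1) gen_closed[OF *(2,3)], symmetric]
      by (intro tensor_proj_eqI cl null *)
        (use * in \<open>auto simp: bilinear_relators_def Let_def simp del: free_module_simps\<close>)
  qed
qed

lemma pure_tensor_closed: "a \<in> carrier A \<Longrightarrow> b \<in> carrier B \<Longrightarrow> t a b \<in> carrier T"
  using pure_tensor_bilinear unfolding bilinear_map_def by blast

text \<open>Uniqueness half of the universal property. Pulled back to the free module, the two maps
  have an equalizer that contains every generator.\<close>

lemma linear_map_tensor_ext:
  assumes W: "module K W" and h: "linear_map K T W h" and g: "linear_map K T W g"
    and eq: "\<And>a b. a \<in> carrier A \<Longrightarrow> b \<in> carrier B \<Longrightarrow> h (t a b) = g (t a b)"
    and x: "x \<in> carrier T"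
  shows "h x = g x"
proof -
  let ?p = "\<lambda>f. tensor_null K A B +>\<^bsub>F\<^esub> f"
  obtain f where f: "f \<in> carrier F" "x = ?p f"
    using x F.carrier_quot_module[OF tensor_null_submodule] unfolding tensor_space_def by blast
  have "f \<in> {f \<in> carrier F. h (?p f) = g (?p f)}"
  proof (rule A.R.free_module_generated[OF F.submodule_equalizer _ f(1)])
    show "linear_map K F W (\<lambda>f. h (?p f))" by (rule linear_map_compose[OF tensor_proj h])
    show "linear_map K F W (\<lambda>f. g (?p f))" by (rule linear_map_compose[OF tensor_proj g])
    show "module K W" by (fact W)
    show "free_gen K z \<in> {f \<in> carrier F. h (?p f) = g (?p f)}"
      if "z \<in> carrier A \<times> carrier B" for z
      using that eq gen_closed unfolding pure_tensor_def by auto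
  qed
  then show ?thesis using f by simp
qed

text \<open>Existence half of the universal property: extend \<open>f\<close> linearly to the free
  module, then factor through the quotient.\<close>

lemma tensor_lift:
  assumes W: "module K W" and f: "bilinear_map K A B W f"
  obtains h where "linear_map K T W h"
    "\<And>a b. a \<in> carrier A \<Longrightarrow> b \<in> carrier B \<Longrightarrow> h (t a b) = f a b"
proof -
  interpret W: module K W by (fact W)
  obtain h0 where h0: "linear_map K F W h0"
    and h0_gen: "\<And>x. x \<in> carrier A \<times> carrier B \<Longrightarrow> h0 (free_gen K x) = case_prod f x"
    by (rule W.free_module_lift[of "carrier A \<times> carrier B" "case_prod f"])
      (use f in \<open>auto simp: bilinear_map_def\<close>)
  have gen: "h0 (free_gen K (a, b)) = f a b" if "a \<in> carrier A" "b \<in> carrier B" for a b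
    using h0_gen[of "(a, b)"] that by simp
  note cl = gen_closed F.a_closed F.smult_closed A.a_closed B.a_closed A.smult_closed B.smult_closed
  \<comment> \<open>Bilinearity of \<open>f\<close> kills the relators; as the kernel is a
    submodule, it then contains everything they generate.\<close>
  have "bilinear_relators K A B \<subseteq> {x \<in> carrier F. h0 x = \<zero>\<^bsub>W\<^esub>}"
  proof
    fix r assume r: "r \<in> bilinear_relators K A B"
    have "h0 r = \<zero>\<^bsub>W\<^esub>"
      using r f unfolding bilinear_relators_def Let_def bilinear_map_def
      by (auto simp: F.linear_map_a_minus[OF h0 W] linear_mapD(2,3)[OF h0] gen cl W.minus_eq W.r_neg
          simp del: free_module_simps)
    then show "r \<in> {x \<in> carrier F. h0 x = \<zero>\<^bsub>W\<^esub>}" using r bilinear_relators_closed by blast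
  qed
  then have "tensor_null K A B \<subseteq> {x \<in> carrier F. h0 x = \<zero>\<^bsub>W\<^esub>}"
    unfolding tensor_null_def
    by (intro F.submodule_gen_least F.submodule_equalizer[OF h0 W.linear_map_const_zero W])
  then have ker: "\<And>n. n \<in> tensor_null K A B \<Longrightarrow> h0 n = \<zero>\<^bsub>W\<^esub>" by blast
  obtain h where h: "linear_map K T W h"
    and h_proj: "\<And>x. x \<in> carrier F \<Longrightarrow> h (tensor_null K A B +>\<^bsub>F\<^esub> x) = h0 x"
    using F.quot_module_lift[OF tensor_null_submodule W h0 ker]
    unfolding tensor_space_def by metis
  show ?thesis
    by (rule that[OF h]) (simp add: pure_tensor_def h_proj gen_closed gen del: free_module_simps)
qed

text \<open>The universal property is applied twice: \<open>L a' b'\<close> lifts the first pair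
  with the second pair fixed, and then for each tensor \<open>x\<close> the map sending
  \<open>a'\<close>, \<open>b'\<close> to \<open>L a' b' x\<close> is lifted in turn.\<close>

lemma tensor_bilinear_lift:
  assumes W: "module K W"
    and left: "\<And>a' b'. a' \<in> carrier A \<Longrightarrow> b' \<in> carrier B \<Longrightarrow> bilinear_map K A B W (\<lambda>a b. \<Phi> a b a' b')"
    and right: "\<And>a b. a \<in> carrier A \<Longrightarrow> b \<in> carrier B \<Longrightarrow> bilinear_map K A B W (\<Phi> a b)"
  obtains \<beta> where "bilinear_map K T T W \<beta>"
    "\<And>a b a' b'. \<lbrakk>a \<in> carrier A; b \<in> carrier B; a' \<in> carrier A; b' \<in> carrier B\<rbrakk> \<Longrightarrow>
      \<beta> (t a b) (t a' b') = \<Phi> a b a' b'"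
proof -
  interpret W: module K W by (fact W)
  have "\<exists>h. linear_map K T W h \<and>
      (\<forall>a\<in>carrier A. \<forall>b\<in>carrier B. h (t a b) = \<Phi> a b a' b')"
    if "a' \<in> carrier A" "b' \<in> carrier B" for a' b'
    using tensor_lift[OF W left[OF that]] by metis
  then obtain L where L: "\<And>a' b'. \<lbrakk>a' \<in> carrier A; b' \<in> carrier B\<rbrakk> \<Longrightarrow> linear_map K T W (L a' b')"
    and L_pure: "\<And>a b a' b'. \<lbrakk>a \<in> carrier A; b \<in> carrier B; a' \<in> carrier A; b' \<in> carrier B\<rbrakk> \<Longrightarrow>
      L a' b' (t a b) = \<Phi> a b a' b'"
    by metis
  \<comment> \<open>The lifts are chosen independently for each \<open>a'\<close>,
    \<open>b'\<close>, so their dependence on these must be checked. Both sides of each law are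
    linear in \<open>x\<close> and agree on pure tensors by \<open>right\<close>.\<close>
  have L_bilinear: "bilinear_map K A B W (\<lambda>a' b'. L a' b' x)" if x: "x \<in> carrier T" for x
    unfolding bilinear_map_def
  proof (intro conjI ballI)
    show "L a' b' x \<in> carrier W" if "a' \<in> carrier A" "b' \<in> carrier B" for a' b'
      using linear_mapD(1)[OF L[OF that] x] .
  next
    fix a a' b assume *: "a \<in> carrier A" "a' \<in> carrier A" "b \<in> carrier B"
    show "L (a \<oplus>\<^bsub>A\<^esub> a') b x = L a b x \<oplus>\<^bsub>W\<^esub> L a' b x"
      by (rule linear_map_tensor_ext[OF W L W.linear_map_add[OF L L] _ x])
        (use * right in \<open>simp_all add: L_pure bilinear_map_def\<close>)
  next
    fix a b b' assume *: "a \<in> carrier A" "b \<in> carrier B" "b' \<in> carrier B"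
    show "L a (b \<oplus>\<^bsub>B\<^esub> b') x = L a b x \<oplus>\<^bsub>W\<^esub> L a b' x"
      by (rule linear_map_tensor_ext[OF W L W.linear_map_add[OF L L] _ x])
        (use * right in \<open>simp_all add: L_pure bilinear_map_def\<close>)
  next
    fix c a b assume *: "c \<in> carrier K" "a \<in> carrier A" "b \<in> carrier B"
    show "L (c \<odot>\<^bsub>A\<^esub> a) b x = c \<odot>\<^bsub>W\<^esub> L a b x"
      by (rule linear_map_tensor_ext[OF W L W.linear_map_smult[OF L] _ x])
        (use * right in \<open>simp_all add: L_pure bilinear_map_def\<close>)
    show "L a (c \<odot>\<^bsub>B\<^esub> b) x = c \<odot>\<^bsub>W\<^esub> L a b x"
      by (rule linear_map_tensor_ext[OF W L W.linear_map_smult[OF L] _ x])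
        (use * right in \<open>simp_all add: L_pure bilinear_map_def\<close>)
  qed
  have "\<exists>h. linear_map K T W h \<and>
      (\<forall>a'\<in>carrier A. \<forall>b'\<in>carrier B. h (t a' b') = L a' b' x)" if "x \<in> carrier T" for x
    using tensor_lift[OF W L_bilinear[OF that]] by metis
  then obtain \<beta> where \<beta>: "\<And>x. x \<in> carrier T \<Longrightarrow> linear_map K T W (\<beta> x)"
    and \<beta>_pure: "\<And>x a' b'. \<lbrakk>x \<in> carrier T; a' \<in> carrier A; b' \<in> carrier B\<rbrakk> \<Longrightarrow>
      \<beta> x (t a' b') = L a' b' x"
    by metis
  \<comment> \<open>The maps \<open>\<beta> x\<close> were also chosen separately. On a pure tensor
    in the second slot \<open>\<beta>\<close> reduces to \<open>L a' b' x\<close>, which is linear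
    in \<open>x\<close>; extensionality in \<open>y\<close> does the rest.\<close>
  have "linear_map K T W (\<lambda>x. \<beta> x y)" if y: "y \<in> carrier T" for y
  proof (rule linear_mapI)
    show "\<beta> x y \<in> carrier W" if "x \<in> carrier T" for x using linear_mapD(1)[OF \<beta>[OF that] y] .
  next
    fix x x' assume *: "x \<in> carrier T" "x' \<in> carrier T"
    show "\<beta> (x \<oplus>\<^bsub>T\<^esub> x') y = \<beta> x y \<oplus>\<^bsub>W\<^esub> \<beta> x' y"
      by (rule linear_map_tensor_ext[OF W \<beta> W.linear_map_add[OF \<beta> \<beta>] _ y])
        (use * in \<open>simp_all add: \<beta>_pure linear_mapD(2)[OF L]\<close>)
  next
    fix c x assume *: "c \<in> carrier K" "x \<in> carrier T"
    show "\<beta> (c \<odot>\<^bsub>T\<^esub> x) y = c \<odot>\<^bsub>W\<^esub> \<beta> x y"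
      by (rule linear_map_tensor_ext[OF W \<beta> W.linear_map_smult[OF \<beta>] _ y])
        (use * in \<open>simp_all add: \<beta>_pure linear_mapD(3)[OF L]\<close>)
  qed
  then have "bilinear_map K T T W \<beta>" using \<beta> by (simp add: bilinear_map_iff)
  then show ?thesis by (rule that) (simp add: \<beta>_pure L_pure pure_tensor_closed)
qed

lemma bilinear_map_tensor_ext:
  assumes W: "module K W" and f: "bilinear_map K T T W f" and g: "bilinear_map K T T W g"
    and eq: "\<And>a b a' b'. \<lbrakk>a \<in> carrier A; b \<in> carrier B; a' \<in> carrier A; b' \<in> carrier B\<rbrakk> \<Longrightarrow>
      f (t a b) (t a' b') = g (t a b) (t a' b')"
    and x: "x \<in> carrier T" and y: "y \<in> carrier T"
  shows "f x y = g x y"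
proof (rule linear_map_tensor_ext[OF W bilinear_mapD(1)[OF f y] bilinear_mapD(1)[OF g y] _ x])
  fix a b assume *: "a \<in> carrier A" "b \<in> carrier B"
  note t = pure_tensor_closed[OF *]
  show "f (t a b) y = g (t a b) y"
    by (rule linear_map_tensor_ext[OF W bilinear_mapD(2)[OF f t] bilinear_mapD(2)[OF g t] _ y])
      (simp add: eq *)
qed

lemma trilinear_map_tensor_ext:
  assumes W: "module K W"
    and f: "\<And>x. x \<in> carrier T \<Longrightarrow> bilinear_map K T T W (f x)"
      "\<And>y z. y \<in> carrier T \<Longrightarrow> z \<in> carrier T \<Longrightarrow> linear_map K T W (\<lambda>x. f x y z)"
    and g: "\<And>x. x \<in> carrier T \<Longrightarrow> bilinear_map K T T W (g x)"
      "\<And>y z. y \<in> carrier T \<Longrightarrow> z \<in> carrier T \<Longrightarrow> linear_map K T W (\<lambda>x. g x y z)"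
    and eq: "\<And>a1 b1 a2 b2 a3 b3. \<lbrakk>a1 \<in> carrier A; b1 \<in> carrier B; a2 \<in> carrier A; b2 \<in> carrier B;
        a3 \<in> carrier A; b3 \<in> carrier B\<rbrakk> \<Longrightarrow>
      f (t a1 b1) (t a2 b2) (t a3 b3) = g (t a1 b1) (t a2 b2) (t a3 b3)"
    and x: "x \<in> carrier T" and y: "y \<in> carrier T" and z: "z \<in> carrier T"
  shows "f x y z = g x y z"
proof (rule linear_map_tensor_ext[OF W f(2)[OF y z] g(2)[OF y z] _ x])
  fix a b assume *: "a \<in> carrier A" "b \<in> carrier B"
  note t = pure_tensor_closed[OF *]
  show "f (t a b) y z = g (t a b) y z"
    by (rule bilinear_map_tensor_ext[OF W f(1)[OF t] g(1)[OF t] _ y z]) (simp add: eq *)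
qed

lemma pure_tensor_bilinear_compose:
  assumes "linear_map K U A p" "linear_map K V B q"
  shows "bilinear_map K U V T (\<lambda>u v. t (p u) (q v))"
  unfolding bilinear_map_iff
  by (intro conjI ballI linear_map_bilinear[OF pure_tensor_bilinear] assms;
      rule linear_mapD(1)[OF assms(1)] linear_mapD(1)[OF assms(2)])

text \<open>The conditions determine a map only on the carrier. The extensional function space fixes
  its values elsewhere to \<open>undefined\<close>, which makes uniqueness an equality of
  functions.\<close>

lemma tensor_bilinear_lift_unique:
  assumes left: "\<And>a' b'. a' \<in> carrier A \<Longrightarrow> b' \<in> carrier B \<Longrightarrow> bilinear_map K A B T (\<lambda>a b. \<Phi> a b a' b')"
    and right: "\<And>a b. a \<in> carrier A \<Longrightarrow> b \<in> carrier B \<Longrightarrow> bilinear_map K A B T (\<Phi> a b)"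
  shows "\<exists>!\<beta> \<in> carrier T \<rightarrow>\<^sub>E carrier T \<rightarrow>\<^sub>E carrier T. bilinear_map K T T T \<beta> \<and>
    (\<forall>a\<in>carrier A. \<forall>a'\<in>carrier A. \<forall>b\<in>carrier B. \<forall>b'\<in>carrier B.
      \<beta> (t a b) (t a' b') = \<Phi> a b a' b')"
proof -
  obtain \<beta> where \<beta>: "bilinear_map K T T T \<beta>"
    and \<beta>_pure: "\<And>a b a' b'. \<lbrakk>a \<in> carrier A; b \<in> carrier B; a' \<in> carrier A; b' \<in> carrier B\<rbrakk> \<Longrightarrow>
      \<beta> (t a b) (t a' b') = \<Phi> a b a' b'"
    using tensor_bilinear_lift[OF T.module_axioms left right] by metis
  define \<gamma> where "\<gamma> = (\<lambda>x\<in>carrier T. \<lambda>y\<in>carrier T. \<beta> x y)"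
  show ?thesis
  proof (rule ex1I[of _ \<gamma>])
    have "bilinear_map K T T T \<gamma>"
      by (subst bilinear_map_cong[of T T \<gamma> \<beta>]) (simp_all add: \<gamma>_def \<beta> T.module_axioms)
    then show "\<gamma> \<in> carrier T \<rightarrow>\<^sub>E carrier T \<rightarrow>\<^sub>E carrier T \<and> bilinear_map K T T T \<gamma> \<and>
      (\<forall>a\<in>carrier A. \<forall>a'\<in>carrier A. \<forall>b\<in>carrier B. \<forall>b'\<in>carrier B.
        \<gamma> (t a b) (t a' b') = \<Phi> a b a' b')"
      by (auto simp: \<gamma>_def \<beta>_pure pure_tensor_closed bilinear_map_closed[OF \<beta>])
  next
    fix \<delta>
    assume \<delta>: "\<delta> \<in> carrier T \<rightarrow>\<^sub>E carrier T \<rightarrow>\<^sub>E carrier T \<and> bilinear_map K T T T \<delta> \<and>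
      (\<forall>a\<in>carrier A. \<forall>a'\<in>carrier A. \<forall>b\<in>carrier B. \<forall>b'\<in>carrier B.
        \<delta> (t a b) (t a' b') = \<Phi> a b a' b')"
    have eq: "\<delta> x y = \<beta> x y" if "x \<in> carrier T" "y \<in> carrier T" for x y
      by (rule bilinear_map_tensor_ext[OF T.module_axioms _ \<beta> _ that])
        (use \<delta> in \<open>simp_all add: \<beta>_pure\<close>)
    have \<delta>': "\<delta> \<in> carrier T \<rightarrow>\<^sub>E carrier T \<rightarrow>\<^sub>E carrier T" using \<delta> by blast
    show "\<delta> = \<gamma>"
    proof (rule ext, rule ext)
      fix x y
      show "\<delta> x y = \<gamma> x y"
      \<comment> \<open>Off the carrier both functions are \<open>undefined\<close>, in the first
        argument as whole functions and in the second as values.\<close>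
      proof (cases "x \<in> carrier T")
        case True
        note \<delta>x = PiE_mem[OF \<delta>' True]
        show ?thesis
        proof (cases "y \<in> carrier T")
          case False
          show ?thesis unfolding PiE_arb[OF \<delta>x False] using True False by (simp add: \<gamma>_def)
        qed (use True eq in \<open>simp add: \<gamma>_def\<close>)
      next
        case False
        show ?thesis unfolding PiE_arb[OF \<delta>' False] using False by (simp add: \<gamma>_def)
      qed
    qed
  qed
qed

text \<open>Each operation has a summand in either order of the factors, and the lift freezes either
  pair, so both placements of the fixed pair occur.\<close>

lemma pure_tensor_prod_bilinear:
  assumes m: "bilinear_map K A A A m" and d: "bilinear_map K B B B d"
    and a: "a \<in> carrier A" and b: "b \<in> carrier B"
  shows "bilinear_map K A B T (\<lambda>a' b'. t (m a a') (d b b'))"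
    and "bilinear_map K A B T (\<lambda>a' b'. t (m a' a) (d b' b))"
  by (rule pure_tensor_bilinear_compose; rule bilinear_mapD[OF m a] bilinear_mapD[OF d b])+

end

section \<open>Pre-Poisson algebras and perm algebras\<close>

locale perm_tensor =
  pre: pre_poisson_algebra K A ast circ + perm: perm_algebra K B dia
  for K (structure) and A (structure) and ast (infixl \<open>\<star>\<close> 75) and circ (infixl \<open>\<triangleright>\<close> 75)
    and B (structure) and dia (infixl \<open>\<diamondop>\<close> 75)
begin

sublocale two_modules K A B
  by (intro two_modules.intro pre.zinbiel.module_axioms perm.module_axioms)

lemma prod_closed [simp, intro]:
  "x \<in> carrier A \<Longrightarrow> y \<in> carrier A \<Longrightarrow> x \<star> y \<in> carrier A"
  "x \<in> carrier A \<Longrightarrow> y \<in> carrier A \<Longrightarrow> x \<triangleright> y \<in> carrier A"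
  "u \<in> carrier B \<Longrightarrow> v \<in> carrier B \<Longrightarrow> u \<diamondop> v \<in> carrier B"
  using bilinear_map_closed[OF pre.zinbiel.bilinear] bilinear_map_closed[OF pre.pre_lie.bilinear]
    bilinear_map_closed[OF perm.bilinear] by auto

lemma vspace_T: "vspace K T"
  by (intro vspace.intro pre.zinbiel.char_zero_field_axioms T.module_axioms)

section \<open>Pre-Poisson identities tensored with a common second factor\<close>

context
  fixes x y z e
  assumes xyz [simp]: "x \<in> carrier A" "y \<in> carrier A" "z \<in> carrier A" and e [simp]: "e \<in> carrier B"
begin

text \<open>Read from left to right, this rewrites right-nested products to left-nested ones, which
  suffices to normalize both sides of associativity.\<close>

lemma zinbiel_tensor: "t (x \<star> (y \<star> z)) e = t (x \<star> y \<star> z) e \<oplus>\<^bsub>T\<^esub> t (y \<star> x \<star> z) e"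
  by (simp add: bilinear_map_distrib(1)[OF pure_tensor_bilinear, symmetric]
        pre.zinbiel.zinbiel)

text \<open>The axiom is put in subtraction-free form so that several instances can be added up
  termwise.\<close>

lemma pre_lie_tensor:
  "t (x \<triangleright> (y \<triangleright> z)) e \<oplus>\<^bsub>T\<^esub> t (y \<triangleright> x \<triangleright> z) e = t (x \<triangleright> y \<triangleright> z) e \<oplus>\<^bsub>T\<^esub> t (y \<triangleright> (x \<triangleright> z)) e"
proof -
  have "x \<triangleright> y \<triangleright> z \<oplus>\<^bsub>A\<^esub> y \<triangleright> (x \<triangleright> z) = y \<triangleright> x \<triangleright> z \<oplus>\<^bsub>A\<^esub> x \<triangleright> (y \<triangleright> z)"
    using pre.pre_lie.pre_lie[OF xyz] by (simp add: pre.zinbiel.minus_eq_minus_iff)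
  then show ?thesis by (simp add: bilinear_map_distrib(1)[OF pure_tensor_bilinear, symmetric]
        pre.zinbiel.a_comm)
qed

lemma commutator_act_tensor:
  "t (x \<triangleright> (y \<star> z)) e \<oplus>\<^bsub>T\<^esub> t (y \<triangleright> x \<star> z) e = t (x \<triangleright> y \<star> z) e \<oplus>\<^bsub>T\<^esub> t (y \<star> (x \<triangleright> z)) e"
proof -
  have "x \<triangleright> y \<star> z \<ominus>\<^bsub>A\<^esub> y \<triangleright> x \<star> z = x \<triangleright> (y \<star> z) \<ominus>\<^bsub>A\<^esub> y \<star> (x \<triangleright> z)"
    using pre.commutator_act[OF xyz]
    by (simp add: bilinear_map_a_minus(1)[OF pre.zinbiel.bilinear
          pre.zinbiel.module_axioms pre.zinbiel.module_axioms pre.zinbiel.module_axioms])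
  then show ?thesis by (simp add: bilinear_map_distrib(1)[OF pure_tensor_bilinear, symmetric]
        pre.zinbiel.minus_eq_minus_iff)
qed

lemma anticommutator_act_tensor:
  "t (x \<star> y \<triangleright> z) e \<oplus>\<^bsub>T\<^esub> t (y \<star> x \<triangleright> z) e = t (x \<star> (y \<triangleright> z)) e \<oplus>\<^bsub>T\<^esub> t (y \<star> (x \<triangleright> z)) e"
  using pre.anticommutator_act[OF xyz] pre.pre_lie.bilinear
  by (simp add: bilinear_map_distrib(1)[OF pure_tensor_bilinear, symmetric] bilinear_map_def)

end

section \<open>Existence and uniqueness of the two operations\<close>

lemma bracket_ex1:
  "\<exists>!br \<in> carrier T \<rightarrow>\<^sub>E carrier T \<rightarrow>\<^sub>E carrier T. is_tensor_bracket K A circ B dia br"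
  unfolding is_tensor_bracket_def Let_def
  by (rule tensor_bilinear_lift_unique[where \<Phi> = "\<lambda>a1 b1 a2 b2.
        t (a1 \<triangleright> a2) (b1 \<diamondop> b2) \<ominus>\<^bsub>T\<^esub> t (a2 \<triangleright> a1) (b2 \<diamondop> b1)"])
    (intro T.bilinear_map_minus pure_tensor_prod_bilinear pre.pre_lie.bilinear perm.bilinear; assumption)+

lemma mult_ex1:
  "\<exists>!mul \<in> carrier T \<rightarrow>\<^sub>E carrier T \<rightarrow>\<^sub>E carrier T. is_tensor_mult K A ast B dia mul"
  unfolding is_tensor_mult_def Let_def
  by (rule tensor_bilinear_lift_unique[where \<Phi> = "\<lambda>a1 b1 a2 b2.
        t (a1 \<star> a2) (b1 \<diamondop> b2) \<oplus>\<^bsub>T\<^esub> t (a2 \<star> a1) (b2 \<diamondop> b1)"])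
    (intro T.bilinear_map_add pure_tensor_prod_bilinear pre.zinbiel.bilinear perm.bilinear; assumption)+

section \<open>Poisson axioms for the two operations\<close>

context
  fixes br mul
  assumes br: "is_tensor_bracket K A circ B dia br" and mul: "is_tensor_mult K A ast B dia mul"
begin

lemma br_bilinear: "bilinear_map K T T T br"
  and br_pure: "\<lbrakk>a1 \<in> carrier A; a2 \<in> carrier A; b1 \<in> carrier B; b2 \<in> carrier B\<rbrakk> \<Longrightarrow>
    br (t a1 b1) (t a2 b2) = t (a1 \<triangleright> a2) (b1 \<diamondop> b2) \<ominus>\<^bsub>T\<^esub> t (a2 \<triangleright> a1) (b2 \<diamondop> b1)"
  using br unfolding is_tensor_bracket_def Let_def by blast+

lemma mul_bilinear: "bilinear_map K T T T mul"
  and mul_pure: "\<lbrakk>a1 \<in> carrier A; a2 \<in> carrier A; b1 \<in> carrier B; b2 \<in> carrier B\<rbrakk> \<Longrightarrow>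
    mul (t a1 b1) (t a2 b2) = t (a1 \<star> a2) (b1 \<diamondop> b2) \<oplus>\<^bsub>T\<^esub> t (a2 \<star> a1) (b2 \<diamondop> b1)"
  using mul unfolding is_tensor_mult_def Let_def by blast+

lemmas op_closed = bilinear_map_closed[OF br_bilinear] bilinear_map_closed[OF mul_bilinear]

text \<open>These rules take apart nested expressions in the two operations and sums, and so
  establish the multilinearity that extension from pure tensors requires.\<close>

lemmas linear_intros = linear_map_id T.linear_map_const_zero T.linear_map_add
  linear_map_bilinear[OF br_bilinear] linear_map_bilinear[OF mul_bilinear] op_closed

lemmas op_add = bilinear_map_distrib[OF br_bilinear] bilinear_map_distrib[OF mul_bilinear]
lemmas T3 = T.module_axioms T.module_axioms T.module_axioms
lemmas op_minus = bilinear_map_a_minus[OF br_bilinear T3] bilinear_map_a_minus[OF mul_bilinear T3]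

lemma mul_commutative: "x \<in> carrier T \<Longrightarrow> y \<in> carrier T \<Longrightarrow> mul x y = mul y x"
  by (rule bilinear_map_tensor_ext[OF T.module_axioms mul_bilinear bilinear_map_swap[OF mul_bilinear]])
    (simp_all add: mul_pure T.M.a_comm pure_tensor_closed)

text \<open>On pure tensors, exchanging the arguments exchanges the positive and the negative
  summand.\<close>

lemma br_anticommutative: "x \<in> carrier T \<Longrightarrow> y \<in> carrier T \<Longrightarrow> br x y \<oplus>\<^bsub>T\<^esub> br y x = \<zero>\<^bsub>T\<^esub>"
proof (rule bilinear_map_tensor_ext[OF T.module_axioms, of "\<lambda>x y. br x y \<oplus>\<^bsub>T\<^esub> br y x" "\<lambda>x y. \<zero>\<^bsub>T\<^esub>"])
  show "bilinear_map K T T T (\<lambda>x y. br x y \<oplus>\<^bsub>T\<^esub> br y x)"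
    by (intro T.bilinear_map_add br_bilinear bilinear_map_swap[OF br_bilinear])
  show "bilinear_map K T T T (\<lambda>x y. \<zero>\<^bsub>T\<^esub>)"
    unfolding bilinear_map_iff by (simp add: T.linear_map_const_zero)
  show "br (t a b) (t a' b') \<oplus>\<^bsub>T\<^esub> br (t a' b') (t a b) = \<zero>\<^bsub>T\<^esub>"
    if "a \<in> carrier A" "b \<in> carrier B" "a' \<in> carrier A" "b' \<in> carrier B" for a b a' b'
    using that by (simp add: br_pure pure_tensor_closed T.M.minus_minus_interchange(2)
        T.M.minus_eq_zero_iff T.M.a_comm)
qed

text \<open>The expression \<open>br x x\<close> is quadratic in \<open>x\<close>, so checking pure
  tensors is not enough. Anticommutativity with equal arguments gives twice \<open>br x x\<close>
  equal to zero, and 2 is cancelled.\<close>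

lemma br_alternating: "x \<in> carrier T \<Longrightarrow> br x x = \<zero>\<^bsub>T\<^esub>"
  using vspace.add_self_eq_zero[OF vspace_T] br_anticommutative op_closed by blast

section \<open>Associativity, Jacobi identity and Leibniz rule on pure tensors\<close>

context
  fixes a1 b1 a2 b2 a3 b3
  assumes a [simp]: "a1 \<in> carrier A" "a2 \<in> carrier A" "a3 \<in> carrier A"
    and b [simp]: "b1 \<in> carrier B" "b2 \<in> carrier B" "b3 \<in> carrier B"
begin

text \<open>Normal forms for the twelve products of the three factors: one for each last factor,
  bracketed to the left with the other two indices increasing.\<close>

lemma perm_products:
  "b1 \<diamondop> (b2 \<diamondop> b3) = b1 \<diamondop> b2 \<diamondop> b3" "b2 \<diamondop> (b1 \<diamondop> b3) = b1 \<diamondop> b2 \<diamondop> b3" "b2 \<diamondop> b1 \<diamondop> b3 = b1 \<diamondop> b2 \<diamondop> b3"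
  "b1 \<diamondop> (b3 \<diamondop> b2) = b1 \<diamondop> b3 \<diamondop> b2" "b3 \<diamondop> (b1 \<diamondop> b2) = b1 \<diamondop> b3 \<diamondop> b2" "b3 \<diamondop> b1 \<diamondop> b2 = b1 \<diamondop> b3 \<diamondop> b2"
  "b2 \<diamondop> (b3 \<diamondop> b1) = b2 \<diamondop> b3 \<diamondop> b1" "b3 \<diamondop> (b2 \<diamondop> b1) = b2 \<diamondop> b3 \<diamondop> b1" "b3 \<diamondop> b2 \<diamondop> b1 = b2 \<diamondop> b3 \<diamondop> b1"
  using perm.perm_assoc perm.perm_left_comm b by metis+

text \<open>The parts with last factor \<open>b1\<close> and \<open>b3\<close> are Zinbiel
  identities. The part with \<open>b2\<close> asks that \<open>a3 \<star> (a1 \<star> a2)\<close>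
  equal \<open>a1 \<star> (a3 \<star> a2)\<close>, which holds because both have the same Zinbiel
  expansion.\<close>

lemma mul_associative_pure:
  "mul (mul (t a1 b1) (t a2 b2)) (t a3 b3) = mul (t a1 b1) (mul (t a2 b2) (t a3 b3))"
  by (simp add: mul_pure op_add pure_tensor_closed perm_products zinbiel_tensor T.M.a_ac)

lemma jacobi_pure:
  "br (t a1 b1) (br (t a2 b2) (t a3 b3)) \<oplus>\<^bsub>T\<^esub> br (t a2 b2) (br (t a3 b3) (t a1 b1))
    \<oplus>\<^bsub>T\<^esub> br (t a3 b3) (br (t a1 b1) (t a2 b2)) = \<zero>\<^bsub>T\<^esub>"
proof -
  let ?e1 = "b2 \<diamondop> b3 \<diamondop> b1" and ?e2 = "b1 \<diamondop> b3 \<diamondop> b2" and ?e3 = "b1 \<diamondop> b2 \<diamondop> b3"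
  note e = pre_lie_tensor[of a2 a3 a1 ?e1] pre_lie_tensor[of a3 a1 a2 ?e2]
    pre_lie_tensor[of a1 a2 a3 ?e3]
  \<comment> \<open>The sum of three pre-Lie identities, one for each last factor. The left side
    consists of the six positive terms of the expanded Jacobi sum, the right side of the six
    negative ones.\<close>
  have "(t (a2 \<triangleright> (a3 \<triangleright> a1)) ?e1 \<oplus>\<^bsub>T\<^esub> t (a3 \<triangleright> a2 \<triangleright> a1) ?e1) \<oplus>\<^bsub>T\<^esub>
      ((t (a3 \<triangleright> (a1 \<triangleright> a2)) ?e2 \<oplus>\<^bsub>T\<^esub> t (a1 \<triangleright> a3 \<triangleright> a2) ?e2) \<oplus>\<^bsub>T\<^esub>
      (t (a1 \<triangleright> (a2 \<triangleright> a3)) ?e3 \<oplus>\<^bsub>T\<^esub> t (a2 \<triangleright> a1 \<triangleright> a3) ?e3)) =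
    (t (a2 \<triangleright> a3 \<triangleright> a1) ?e1 \<oplus>\<^bsub>T\<^esub> t (a3 \<triangleright> (a2 \<triangleright> a1)) ?e1) \<oplus>\<^bsub>T\<^esub>
      ((t (a3 \<triangleright> a1 \<triangleright> a2) ?e2 \<oplus>\<^bsub>T\<^esub> t (a1 \<triangleright> (a3 \<triangleright> a2)) ?e2) \<oplus>\<^bsub>T\<^esub>
      (t (a1 \<triangleright> a2 \<triangleright> a3) ?e3 \<oplus>\<^bsub>T\<^esub> t (a2 \<triangleright> (a1 \<triangleright> a3)) ?e3))"
    by (simp only: e a b prod_closed)
  then show ?thesis
    \<comment> \<open>First the Jacobi sum is collected into one difference, whose vanishing is an
      equality of two sums; then both are reordered to match.\<close>
    by (simp add: br_pure op_minus pure_tensor_closed perm_products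
        T.M.minus_minus_interchange(1,2) T.M.minus_eq_zero_iff) (simp add: pure_tensor_closed T.M.a_ac)
qed

lemma leibniz_pure:
  "br (t a1 b1) (mul (t a2 b2) (t a3 b3)) =
    mul (br (t a1 b1) (t a2 b2)) (t a3 b3) \<oplus>\<^bsub>T\<^esub> mul (t a2 b2) (br (t a1 b1) (t a3 b3))"
proof -
  let ?e1 = "b2 \<diamondop> b3 \<diamondop> b1" and ?e2 = "b1 \<diamondop> b3 \<diamondop> b2" and ?e3 = "b1 \<diamondop> b2 \<diamondop> b3"
  note e = anticommutator_act_tensor[of a2 a3 a1 ?e1] commutator_act_tensor[of a1 a3 a2 ?e2]
    commutator_act_tensor[of a1 a2 a3 ?e3]
  \<comment> \<open>The part ending in \<open>b1\<close> is governed by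
    \<open>anticommutator_act\<close>, the other two by \<open>commutator_act\<close>. All terms
    ending in \<open>b1\<close> carry a minus sign and are moved across, hence the exchanged sides
    of that identity.\<close>
  have "(t (a2 \<star> (a3 \<triangleright> a1)) ?e1 \<oplus>\<^bsub>T\<^esub> t (a3 \<star> (a2 \<triangleright> a1)) ?e1) \<oplus>\<^bsub>T\<^esub>
      ((t (a1 \<triangleright> (a3 \<star> a2)) ?e2 \<oplus>\<^bsub>T\<^esub> t (a3 \<triangleright> a1 \<star> a2) ?e2) \<oplus>\<^bsub>T\<^esub>
      (t (a1 \<triangleright> (a2 \<star> a3)) ?e3 \<oplus>\<^bsub>T\<^esub> t (a2 \<triangleright> a1 \<star> a3) ?e3)) =
    (t (a2 \<star> a3 \<triangleright> a1) ?e1 \<oplus>\<^bsub>T\<^esub> t (a3 \<star> a2 \<triangleright> a1) ?e1) \<oplus>\<^bsub>T\<^esub>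
      ((t (a1 \<triangleright> a3 \<star> a2) ?e2 \<oplus>\<^bsub>T\<^esub> t (a3 \<star> (a1 \<triangleright> a2)) ?e2) \<oplus>\<^bsub>T\<^esub>
      (t (a1 \<triangleright> a2 \<star> a3) ?e3 \<oplus>\<^bsub>T\<^esub> t (a2 \<star> (a1 \<triangleright> a3)) ?e3))"
    by (simp only: e a b prod_closed)
  then show ?thesis
    by (simp add: br_pure mul_pure op_minus op_add pure_tensor_closed perm_products
        T.M.minus_minus_interchange(2) T.M.minus_eq_minus_iff) (simp add: pure_tensor_closed T.M.a_ac)
qed

end

section \<open>Extension to arbitrary tensors\<close>

lemma mul_associative:
  assumes "x \<in> carrier T" "y \<in> carrier T" "z \<in> carrier T"
  shows "mul (mul x y) z = mul x (mul y z)"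
  by (rule trilinear_map_tensor_ext[OF T.module_axioms, of "\<lambda>x y z. mul (mul x y) z"])
    (use assms in \<open>auto simp: mul_associative_pure bilinear_map_iff intro!: linear_intros\<close>)

lemma br_jacobi:
  assumes "x \<in> carrier T" "y \<in> carrier T" "z \<in> carrier T"
  shows "br x (br y z) \<oplus>\<^bsub>T\<^esub> br y (br z x) \<oplus>\<^bsub>T\<^esub> br z (br x y) = \<zero>\<^bsub>T\<^esub>"
  by (rule trilinear_map_tensor_ext[OF T.module_axioms,
        of "\<lambda>x y z. br x (br y z) \<oplus>\<^bsub>T\<^esub> br y (br z x) \<oplus>\<^bsub>T\<^esub> br z (br x y)" "\<lambda>x y z. \<zero>\<^bsub>T\<^esub>"])
    (use assms in \<open>auto simp: jacobi_pure bilinear_map_iff intro!: linear_intros\<close>)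

lemma br_leibniz:
  assumes "x \<in> carrier T" "y \<in> carrier T" "z \<in> carrier T"
  shows "br x (mul y z) = mul (br x y) z \<oplus>\<^bsub>T\<^esub> mul y (br x z)"
  by (rule trilinear_map_tensor_ext[OF T.module_axioms, of "\<lambda>x y z. br x (mul y z)"])
    (use assms in \<open>auto simp: leibniz_pure bilinear_map_iff intro!: linear_intros\<close>)

lemma poisson_algebra_tensor: "poisson_algebra K T mul br"
  by (intro poisson_algebra.intro comm_assoc_algebra.intro lie_algebra.intro bilinear_algebra.intro
      bilinear_algebra_axioms.intro comm_assoc_algebra_axioms.intro lie_algebra_axioms.intro
      poisson_algebra_axioms.intro vspace_T br_bilinear mul_bilinear mul_commutative
      mul_associative br_alternating br_jacobi br_leibniz)

end

end

theorem proposition2p11: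
  fixes K :: "('k, 'r) ring_scheme"
    and A :: "('k, 'a, 'm) module_scheme"
    and B :: "('k, 'b, 'n) module_scheme"
    and ast circ :: "'a \<Rightarrow> 'a \<Rightarrow> 'a"
    and dia :: "'b \<Rightarrow> 'b \<Rightarrow> 'b"
  assumes "pre_poisson_algebra K A ast circ"
    and "perm_algebra K B dia"
  defines "T \<equiv> tensor_space K A B"
  shows "(\<exists>!br \<in> carrier T \<rightarrow>\<^sub>E carrier T \<rightarrow>\<^sub>E carrier T. is_tensor_bracket K A circ B dia br) \<and>
    (\<exists>!mul \<in> carrier T \<rightarrow>\<^sub>E carrier T \<rightarrow>\<^sub>E carrier T. is_tensor_mult K A ast B dia mul) \<and>
    (\<forall>br mul. is_tensor_bracket K A circ B dia br \<and> is_tensor_mult K A ast B dia mul \<longrightarrow>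
      poisson_algebra K T mul br)"
proof -
  interpret perm_tensor K A ast circ B dia
    using assms(1,2) by (rule perm_tensor.intro)
  show ?thesis
    unfolding T_def using bracket_ex1 mult_ex1 poisson_algebra_tensor by blast
qed

end
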